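(* Let $W$ be a vector space over $\mathbb{C}$ and let $V$ be a subspace of $\mathcal{E}_{G_1}(W)=\mathrm{Hom}(W,W((x)))$ such that any ordered sequence in $V$ of length $2$ or $3$ is compatible, and such that $1_W\in V$ and $\psi(x)_n\phi(x)\in V$ for all $\psi(x),\phi(x)\in V$, $n\in\mathbb{Z}$. Then $(V,Y_{\mathcal{E}},1_W)$ carries the structure of a weak axiomatic $G_1$-vertex algebra with $W$ as a natural faithful module, where the vertex operator map $Y_W$ is given by $Y_W(\alpha(x),x_0)=\alpha(x_0)$ for $\alpha(x)\in V$. Furthermore, assume that for any $\psi(x),\theta(x)\in V$ there exists a nonnegative integer $k$ such that for every $\phi(x)\in V$ there exists a nonnegative integer $k'$ such that $$(x-y)^{k'}(y-z)^{k'}(x-z)^{k}\psi(x)\phi(y)\theta(z)\in \mathrm{Hom}(W,W((x,y,z))).$$ Then $(V,Y_{\mathcal{E}},1_W)$ carries the structure of an axiomatic $G_1$-vertex algebra.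
   Context: All vector spaces are over $\mathbb{C}$; $\mathbb{N}$ denotes the nonnegative integers. For a vector space $U$: $U[[x,x^{-1}]]=\{\sum_{n\in\mathbb{Z}}a(n)x^n\}$, $U((x))$ is the space of such series with only finitely many negative powers, and $U((x_1,\dots,x_n))=U[[x_1,\dots,x_n]][x_1^{-1},\dots,x_n^{-1}]$. Binomial convention: for $n\in\mathbb{Z}$, $(x_1\pm x_2)^n$ is expanded in nonnegative powers of the second variable $x_2$; likewise $f(x_0+x_2)$ is expanded in nonnegative powers of $x_2$, and $(-y+x)^n$ in nonnegative powers of $x$. $\mathrm{Res}_x$ is the coefficient of $x^{-1}$. Axiomatic $G_1$-vertex algebra: a vector space $V$ with a linear map $Y(\cdot,x):V\to(\mathrm{End}\,V)[[x,x^{-1}]]$, $v\mapsto Y(v,x)=\sum_n v_nx^{-n-1}$, and a vector $\mathbf{1}\in V$ such that: for $u,v\in V$, $u_nv=0$ for $n$ sufficiently large; $Y(\mathbf{1},x)=1$; $Y(v,x)\mathbf{1}\in V[[x]]$ with $\lim_{x\to0}Y(v,x)\mathbf{1}=v$ for $v\in V$; and for $u,w\in V$ there exists $l\in\mathbb{N}$ such that for all $v\in V$, $(x_0+x_2)^lY(u,x_0+x_2)Y(v,x_2)w=(x_0+x_2)^lY(Y(u,x_0)v,x_2)w$ (weak associativity). A weak axiomatic $G_1$-vertex algebra is the same except that $l$ may depend on all of $u,v,w$. Module for a weak axiomatic $G_1$-vertex algebra $V$: a vector space $W$ with a linear map $Y_W(\cdot,x):V\to(\mathrm{End}\,W)[[x,x^{-1}]]$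 such that $Y_W(v,x)w\in W((x))$ for $v\in V,w\in W$, $Y_W(\mathbf{1},x)=1_W$, and for $u,v\in V$, $w\in W$ there is $l\in\mathbb{N}$ with $(x_0+x_2)^lY_W(u,x_0+x_2)Y_W(v,x_2)w=(x_0+x_2)^lY_W(Y(u,x_0)v,x_2)w$. It is faithful if $Y_W$ is injective. Elements of $\mathcal{E}_{G_1}(W)=\mathrm{Hom}(W,W((x)))$ are called weak $G_1$-vertex operators on $W$; $1_W$ is the identity operator. An ordered sequence $(\psi^{(1)},\dots,\psi^{(r)})$ in $\mathcal{E}_{G_1}(W)$ is compatible if there is $k\in\mathbb{N}$ with $\left(\prod_{1\le i<j\le r}(x_i-x_j)^k\right)\psi^{(1)}(x_1)\cdots\psi^{(r)}(x_r)\in\mathrm{Hom}(W,W((x_1,\dots,x_r)))$. If $(a(x),b(x))$ is compatible, define $T(a(x)b(y))=(-y+x)^{-k}\left((x-y)^ka(x)b(y)\right)\in\mathrm{Hom}(W,W((y))((x)))$ for any $k\in\mathbb{N}$ with $(x-y)^ka(x)b(y)\in\mathrm{Hom}(W,W((x,y)))$ (this is independent of $k$), and for $n\in\mathbb{Z}$ define $a(x)_nb(x)=\mathrm{Res}_{x_1}\left((x_1-x)^na(x_1)b(x)-(-x+x_1)^nT(a(x_1)b(x))\right)\in\mathcal{E}_{G_1}(W)$, and $Y_{\mathcal{E}}(a(x),x_0)b(x)=\sum_{n\in\mathbb{Z}}a(x)_nb(x)\,x_0^{-n-1}$. *)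

theory Defs
  imports Complex_Main "HOL-Library.Function_Algebras" "HOL-Library.Groups_Big_Fun"
begin

text \<open>
  A formal series with vector coefficients in finitely many variables, numbered from 0, is
  represented by its coefficient function \<open>f :: int list \<Rightarrow> 'w\<close>: the coefficient of
  \<open>x_0^(e_0) \<cdots> x_(r-1)^(e_(r-1))\<close> is \<open>f [e_0, \<dots>, e_(r-1)]\<close>, and only the values on lists of length
  \<open>r\<close> are meaningful. A series in one variable is a function \<open>int \<Rightarrow> 'w\<close>, and
  an operator-valued series \<open>Y(v,x)\<close> is a function \<open>Y v :: 'w \<Rightarrow> int \<Rightarrow> 'w\<close>, where \<open>Y v w n\<close> is the
  coefficient of \<open>x^n\<close> in \<open>Y(v,x)w\<close>. Thus the mode \<open>v_n w\<close> is \<open>Y v w (-n-1)\<close>.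

  Complex vector spaces are given by a scalar multiplication \<open>sc\<close> on an additive abelian group.
  \<^const>\<open>Sum_any\<close> is the sum of a finitely supported family; every coefficient of a product or
  substitution below that occurs in a well-defined expression is such a sum.
\<close>

definition laurent1 :: "(int \<Rightarrow> 'w::zero) \<Rightarrow> bool" where
  "laurent1 f \<longleftrightarrow> (\<exists>N. \<forall>n<N. f n = 0)"

definition laurent :: "nat \<Rightarrow> (int list \<Rightarrow> 'w::zero) \<Rightarrow> bool" where
  "laurent r f \<longleftrightarrow> (\<exists>N. \<forall>e. length e = r \<and> (\<exists>i<r. e ! i < N) \<longrightarrow> f e = 0)"

definition E_G1 :: "(complex \<Rightarrow> 'w \<Rightarrow> 'w) \<Rightarrow> ('w::ab_group_add \<Rightarrow> int \<Rightarrow> 'w) set" where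
  "E_G1 sc = {a. (\<forall>n. Vector_Spaces.linear sc sc (\<lambda>w. a w n)) \<and> (\<forall>w. laurent1 (a w))}"

definition Hom_laurent ::
  "(complex \<Rightarrow> 'w \<Rightarrow> 'w) \<Rightarrow> nat \<Rightarrow> ('w::ab_group_add \<Rightarrow> int list \<Rightarrow> 'w) set" where
  "Hom_laurent sc r =
     {F. (\<forall>e. length e = r \<longrightarrow> Vector_Spaces.linear sc sc (\<lambda>w. F w e)) \<and> (\<forall>w. laurent r (F w))}"

definition op_scale :: "(complex \<Rightarrow> 'w \<Rightarrow> 'w) \<Rightarrow> complex \<Rightarrow> ('w \<Rightarrow> int \<Rightarrow> 'w) \<Rightarrow> ('w \<Rightarrow> int \<Rightarrow> 'w)" where
  "op_scale sc c a = (\<lambda>w n. sc c (a w n))"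

definition id_op :: "'w::zero \<Rightarrow> int \<Rightarrow> 'w" where
  "id_op w n = (if n = 0 then w else 0)"

text \<open>
  The product \<open>(c x_i + d x_j)^n f\<close>, where the binomial is expanded in nonnegative powers
  of its second term \<open>d x_j\<close>; \<open>i \<noteq> j\<close> are the numbers of the variables. In particular \<open>(-y+x)^n\<close>,
  with \<open>x\<close>, \<open>y\<close> numbered 0 and 1, has \<open>i = 1\<close>, \<open>c = -1\<close>, \<open>j = 0\<close>, \<open>d = 1\<close>.
\<close>

definition binom_mult ::
  "(complex \<Rightarrow> 'w \<Rightarrow> 'w) \<Rightarrow> complex \<Rightarrow> nat \<Rightarrow> complex \<Rightarrow> nat \<Rightarrow> int
    \<Rightarrow> (int list \<Rightarrow> 'w::ab_group_add) \<Rightarrow> int list \<Rightarrow> 'w" where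
  "binom_mult sc c i d j n f e =
     Sum_any (\<lambda>t::nat. sc ((of_int n gchoose t) * c powi (n - int t) * d ^ t)
       (f (e[i := e ! i - (n - int t), j := e ! j - int t])))"

text \<open>From \<open>f(x_1, x_2)\<close> to \<open>f(x_0 + x_2, x_2)\<close>, expanded in nonnegative powers of \<open>x_2\<close>; the result
  is a series in \<open>x_0, x_2\<close> (in this order).\<close>

definition subst_sum ::
  "(complex \<Rightarrow> 'w \<Rightarrow> 'w) \<Rightarrow> (int list \<Rightarrow> 'w::ab_group_add) \<Rightarrow> int list \<Rightarrow> 'w" where
  "subst_sum sc f e =
     Sum_any (\<lambda>t::nat. sc (of_int (e ! 0 + int t) gchoose t) (f [e ! 0 + int t, e ! 1 - int t]))"

fun op_prod :: "('w::zero \<Rightarrow> int \<Rightarrow> 'w) list \<Rightarrow> 'w \<Rightarrow> int list \<Rightarrow> 'w" where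
  "op_prod [] w [] = w"
| "op_prod (a # as) w (n # ns) = a (op_prod as w ns) n"
| "op_prod _ _ _ = 0"

definition compatible ::
  "(complex \<Rightarrow> 'w \<Rightarrow> 'w) \<Rightarrow> ('w::ab_group_add \<Rightarrow> int \<Rightarrow> 'w) list \<Rightarrow> bool" where
  "compatible sc \<psi>s \<longleftrightarrow> (\<exists>k::nat.
     (\<lambda>w. fold (\<lambda>(i, j). binom_mult sc 1 i (-1) j (int k))
            [(i, j). i \<leftarrow> [0..<length \<psi>s], j \<leftarrow> [Suc i..<length \<psi>s]] (op_prod \<psi>s w))
       \<in> Hom_laurent sc (length \<psi>s))"

text \<open>The value of \<open>T_op\<close> on a compatible pair does not depend on the choice of \<open>k\<close>.\<close>

definition T_op ::
  "(complex \<Rightarrow> 'w \<Rightarrow> 'w) \<Rightarrow> ('w::ab_group_add \<Rightarrow> int \<Rightarrow> 'w) \<Rightarrow> ('w \<Rightarrow> int \<Rightarrow> 'w)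
    \<Rightarrow> 'w \<Rightarrow> int list \<Rightarrow> 'w" where
  "T_op sc a b =
     (let k = (SOME k::nat. (\<lambda>w. binom_mult sc 1 0 (-1) 1 (int k) (op_prod [a, b] w))
                \<in> Hom_laurent sc 2)
      in (\<lambda>w. binom_mult sc (-1) 1 1 0 (- int k)
                (binom_mult sc 1 0 (-1) 1 (int k) (op_prod [a, b] w))))"

text \<open>Variables 0 and 1 are \<open>x_1\<close> and \<open>x\<close>; the residue is the coefficient at exponent \<open>-1\<close> of
  variable 0.\<close>

definition nth_prod ::
  "(complex \<Rightarrow> 'w \<Rightarrow> 'w) \<Rightarrow> ('w::ab_group_add \<Rightarrow> int \<Rightarrow> 'w) \<Rightarrow> int \<Rightarrow> ('w \<Rightarrow> int \<Rightarrow> 'w)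
    \<Rightarrow> 'w \<Rightarrow> int \<Rightarrow> 'w" where
  "nth_prod sc a n b = (\<lambda>w m.
     binom_mult sc 1 0 (-1) 1 n (op_prod [a, b] w) [-1, m]
     - binom_mult sc (-1) 1 1 0 n (T_op sc a b w) [-1, m])"

definition Y_E ::
  "(complex \<Rightarrow> 'w \<Rightarrow> 'w) \<Rightarrow> ('w::ab_group_add \<Rightarrow> int \<Rightarrow> 'w) \<Rightarrow> ('w \<Rightarrow> int \<Rightarrow> 'w)
    \<Rightarrow> int \<Rightarrow> ('w \<Rightarrow> int \<Rightarrow> 'w)" where
  "Y_E sc a b m = nth_prod sc a (- m - 1) b"

text \<open>The identity
  \<open>(x_0+x_2)^l Y_W(u,x_0+x_2) Y_W(v,x_2) w = (x_0+x_2)^l Y_W(Y(u,x_0)v,x_2) w\<close>.\<close>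

definition weak_assoc ::
  "(complex \<Rightarrow> 'w \<Rightarrow> 'w) \<Rightarrow> ('v \<Rightarrow> 'v \<Rightarrow> int \<Rightarrow> 'v) \<Rightarrow> ('v \<Rightarrow> 'w::ab_group_add \<Rightarrow> int \<Rightarrow> 'w)
    \<Rightarrow> nat \<Rightarrow> 'v \<Rightarrow> 'v \<Rightarrow> 'w \<Rightarrow> bool" where
  "weak_assoc sc Y Y\<^sub>W l u v w \<longleftrightarrow> (\<forall>p q.
     binom_mult sc 1 0 1 1 (int l) (subst_sum sc (op_prod [Y\<^sub>W u, Y\<^sub>W v] w)) [p, q]
     = binom_mult sc 1 0 1 1 (int l) (\<lambda>e. Y\<^sub>W (Y u v (e ! 0)) w (e ! 1)) [p, q])"

text \<open>The underlying vector space is the subspace \<open>V\<close> of the ambient type, so that spaces of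
  vertex operators can be used; values of \<open>Y\<close> outside \<open>V\<close> are irrelevant.\<close>

locale G1_vertex_algebra_base = vector_space sc
  for sc :: "complex \<Rightarrow> 'v::ab_group_add \<Rightarrow> 'v" +
  fixes V :: "'v set" and Y :: "'v \<Rightarrow> 'v \<Rightarrow> int \<Rightarrow> 'v" and vac :: 'v
  assumes subspace_V: "subspace V"
    and vac_in: "vac \<in> V"
    and Y_in: "\<lbrakk>u \<in> V; v \<in> V\<rbrakk> \<Longrightarrow> Y u v n \<in> V"
    and Y_add_left: "\<lbrakk>u \<in> V; u' \<in> V; v \<in> V\<rbrakk> \<Longrightarrow> Y (u + u') v n = Y u v n + Y u' v n"
    and Y_scale_left: "\<lbrakk>u \<in> V; v \<in> V\<rbrakk> \<Longrightarrow> Y (sc c u) v n = sc c (Y u v n)"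
    and Y_add_right: "\<lbrakk>u \<in> V; v \<in> V; v' \<in> V\<rbrakk> \<Longrightarrow> Y u (v + v') n = Y u v n + Y u v' n"
    and Y_scale_right: "\<lbrakk>u \<in> V; v \<in> V\<rbrakk> \<Longrightarrow> Y u (sc c v) n = sc c (Y u v n)"
    and truncation: "\<lbrakk>u \<in> V; v \<in> V\<rbrakk> \<Longrightarrow> laurent1 (Y u v)"
    and vacuum: "v \<in> V \<Longrightarrow> Y vac v n = (if n = 0 then v else 0)"
    and creation_regular: "\<lbrakk>v \<in> V; n < 0\<rbrakk> \<Longrightarrow> Y v vac n = 0"
    and creation: "v \<in> V \<Longrightarrow> Y v vac 0 = v"

locale weak_axiomatic_G1_vertex_algebra = G1_vertex_algebra_base +
  assumes weak_associativity: "\<lbrakk>u \<in> V; v \<in> V; w \<in> V\<rbrakk> \<Longrightarrow> \<exists>l. weak_assoc sc Y Y l u v w"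

locale axiomatic_G1_vertex_algebra = G1_vertex_algebra_base +
  assumes weak_associativity: "\<lbrakk>u \<in> V; w \<in> V\<rbrakk> \<Longrightarrow> \<exists>l. \<forall>v\<in>V. weak_assoc sc Y Y l u v w"

locale G1_module = weak_axiomatic_G1_vertex_algebra sc V Y vac + W: vector_space scW
  for sc :: "complex \<Rightarrow> 'v::ab_group_add \<Rightarrow> 'v" and V Y vac
    and scW :: "complex \<Rightarrow> 'w::ab_group_add \<Rightarrow> 'w" +
  fixes Y\<^sub>W :: "'v \<Rightarrow> 'w \<Rightarrow> int \<Rightarrow> 'w"
  assumes YW_linear: "v \<in> V \<Longrightarrow> Vector_Spaces.linear scW scW (\<lambda>w. Y\<^sub>W v w n)"
    and YW_add: "\<lbrakk>u \<in> V; v \<in> V\<rbrakk> \<Longrightarrow> Y\<^sub>W (u + v) w n = Y\<^sub>W u w n + Y\<^sub>W v w n"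
    and YW_scale: "v \<in> V \<Longrightarrow> Y\<^sub>W (sc c v) w n = scW c (Y\<^sub>W v w n)"
    and YW_truncation: "v \<in> V \<Longrightarrow> laurent1 (Y\<^sub>W v w)"
    and YW_vacuum: "Y\<^sub>W vac w n = (if n = 0 then w else 0)"
    and YW_weak_associativity: "\<lbrakk>u \<in> V; v \<in> V\<rbrakk> \<Longrightarrow> \<exists>l. weak_assoc scW Y Y\<^sub>W l u v w"

locale faithful_G1_module = G1_module +
  assumes faithful: "inj_on Y\<^sub>W V"

end

theory Submission
  imports Defs "HOL-Computational_Algebra.Formal_Power_Series"
begin

text \<open>
  If \<open>F(x_1,x) = (x_1-x)^k a(x_1) b(x)\<close> lies in \<open>Hom(W,W((x_1,x)))\<close>, then
  \<open>x_0^k Y_E(a(x),x_0) b(x) = F(x+x_0,x)\<close>. Applying this twice to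
  \<open>G(x,y,z) = (x-y)^k' (y-z)^k' (x-z)^k \<psi>(x) \<phi>(y) \<theta>(z)\<close> in \<open>Hom(W,W((x,y,z)))\<close> yields
  \<open>x_1^k x_2^k' (x_1-x_2)^k' Y_E(\<psi>,x_1) Y_E(\<phi>,x_2) \<theta>(z) = G(z+x_1,z+x_2,z)\<close> and
  \<open>x_0^k' x_2^k' (x_0+x_2)^k Y_E(Y_E(\<psi>,x_0)\<phi>,x_2) \<theta>(z) = G(z+x_2+x_0,z+x_2,z)\<close>.
  Substituting \<open>x_1 = x_0+x_2\<close> and cancelling \<open>x_0^k' x_2^k'\<close> gives weak associativity with
  \<open>l = k\<close>, the exponent of \<open>x-z\<close>. For the action on \<open>w \<in> W\<close>, it suffices that \<open>x_1^l\<close> clears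
  the pole of \<open>F(x_1,x)w\<close> in \<open>x_1\<close>: on nonnegative powers of \<open>x_1\<close> the expansions of
  \<open>x_1 = x_0+x_2\<close> and \<open>x_1 = x_2+x_0\<close> coincide.
\<close>

subsection \<open>Binomial coefficients with integer lower index\<close>

text \<open>The definition of \<open>Y_E\<close> mixes two expansions of \<open>(x_1-x)^n\<close>,
  and \<open>T_op\<close> hides a choice of \<open>k\<close>. Both difficulties disappear at the
  level of coefficients: each half of the residue pairs a series with an array of binomial
  coefficients, all these arrays obey the same Pascal rule, and that rule alone turns multiplication
  by \<open>x-z\<close> into a shift of the exponent of \<open>x_0\<close>. Both halves can
  therefore be moved onto the pole-free \<open>F\<close>, where their arrays add up to the Taylor
  array.

  Two obstacles shape the iterated case. The exponent \<open>k'\<close> clears the triple product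
  but perhaps not the pairs \<open>\<psi>\<phi>\<close> and \<open>\<phi>\<theta>\<close>. It may be
  raised at will, because its factors end up as powers of \<open>x_0\<close> and \<open>x_2\<close>
  that cancel, whereas \<open>k\<close> must stay as given: it becomes the \<open>l\<close> that may
  not depend on \<open>\<phi>\<close>. Moreover, after the inner expansion the remaining factors mix
  the new variable with the old ones, and the intermediate series still have poles. The relation
  \<open>expands\<close> survives such factors, and its uniqueness identifies the end result with
  the Taylor expansion of \<open>G\<close>.\<close>

definition ibinom :: "int \<Rightarrow> int \<Rightarrow> complex" where
  "ibinom i s = (if s < 0 then 0 else of_int i gchoose nat s)"

lemma ibinom_neg [simp]: "s < 0 \<Longrightarrow> ibinom i s = 0"
  by (simp add: ibinom_def)

lemma ibinom_0 [simp]: "ibinom i 0 = 1"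
  by (simp add: ibinom_def)

lemma ibinom_of_nat: "ibinom i (int t) = of_int i gchoose t"
  by (simp add: ibinom_def)

text \<open>Extending the lower index by zero makes Pascal's rule hold at all integers without side
  conditions, so arrays built from \<open>ibinom\<close> satisfy it on the whole plane.\<close>

lemma ibinom_Pascal: "ibinom (i + 1) s = ibinom i (s - 1) + ibinom i s"
proof (cases "s > 0")
  case True
  then obtain k where "s = int (Suc k)"
    by (metis gr0_implies_Suc zero_less_imp_eq_int)
  then show ?thesis
    by (simp add: ibinom_def gbinomial_Suc_Suc nat_add_distrib)
qed (auto simp: ibinom_def)

lemma ibinom_of_nat_of_nat: "ibinom (int n) (int t) = of_nat (n choose t)"
  by (simp add: ibinom_def binomial_gbinomial)

lemma ibinom_eq_0: "0 \<le> i \<Longrightarrow> i < s \<Longrightarrow> ibinom i s = 0"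
  using ibinom_of_nat_of_nat[of "nat i" "nat s"] by (simp add: binomial_eq_0)

lemma ibinom_symmetric:
  assumes "0 \<le> i"
  shows "ibinom i (i - s) = ibinom i s"
proof (cases "0 \<le> s \<and> s \<le> i")
  case True
  define n t where "n = nat i" and "t = nat s"
  with True have "i = int n" "s = int t" "t \<le> n"
    by (auto simp: nat_le_iff)
  then have "ibinom i (i - s) = ibinom (int n) (int (n - t))"
    by (simp add: of_nat_diff)
  also have "\<dots> = ibinom i s"
    using binomial_symmetric[OF \<open>t \<le> n\<close>] \<open>i = int n\<close> \<open>s = int t\<close>
    by (simp only: ibinom_of_nat_of_nat)
  finally show ?thesis .
next
  case False
  then show ?thesis
    using assms by (auto simp: ibinom_eq_0 not_le)
qed

lemma ibinom_negate: "ibinom i (int t) = (-1) ^ t * ibinom (int t - i - 1) (int t)"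
  using gbinomial_negated_upper[of "of_int i :: complex" t] by (simp add: ibinom_def)

text \<open>Trinomial revision splits off \<open>ibinom i p\<close>, and Vandermonde sums the rest.
  In generating functions: both sides are the coefficient of \<open>x_0^p x_2^q\<close> in
  \<open>(z+x_2+x_0)^i (z+x_2)^j\<close>, on the left after passing through the powers
  \<open>x_1^l\<close> of \<open>x_1 = x_0+x_2\<close>.\<close>

lemma ibinom_trinomial_Vandermonde:
  "(\<Sum>l=0..p+q. ibinom l (l - p) * (ibinom i l * ibinom j (p + q - l))) = ibinom i p * ibinom (i + j - p) q"
proof (cases "p < 0 \<or> q < 0")
  case True
  have "(\<Sum>l=0..p+q. ibinom l (l - p) * (ibinom i l * ibinom j (p + q - l))) = 0"
    by (rule sum.neutral) (use True in \<open>auto simp: ibinom_eq_0\<close>)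
  with True show ?thesis by auto
next
  case False
  define a b where "a = nat p" and "b = nat q"
  with False have ab: "p = int a" "q = int b"
    by simp_all
  have *: "ibinom l (l - p) * (ibinom i l * ibinom j (p + q - l)) =
      (if l \<in> int ` {a..b+a} then ibinom i p * (ibinom (i - p) (l - p) * ibinom j (p + q - l)) else 0)"
    if l: "l \<in> {0..p+q}" for l
  proof (cases "p \<le> l")
    case True
    define n where "n = nat l"
    with l ab True have n: "l = int n" "a \<le> n" "n \<le> b + a"
      by simp_all
    have "ibinom l (l - p) = of_nat n gchoose a"
      using ibinom_symmetric[of l p] n by (simp add: ab ibinom_of_nat)
    moreover have "ibinom i l = of_int i gchoose n" "ibinom i p = of_int i gchoose a"
      by (simp_all add: n ab ibinom_of_nat)
    moreover have "ibinom (i - p) (l - p) = (of_int i - of_nat a) gchoose (n - a)"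
      using n by (simp add: ibinom_def ab nat_diff_distrib')
    ultimately have "ibinom l (l - p) * ibinom i l = ibinom i p * ibinom (i - p) (l - p)"
      using gbinomial_trinomial_revision[of a n "of_int i :: complex"] n
      by (simp add: mult.commute)
    moreover have "l \<in> int ` {a..b+a}"
      using n by auto
    ultimately show ?thesis
      by (simp only: if_True flip: mult.assoc)
  next
    case False
    then have "l \<notin> int ` {a..b+a}"
      by (auto simp: ab)
    with False show ?thesis by simp
  qed
  have "(\<Sum>l=0..p+q. ibinom l (l - p) * (ibinom i l * ibinom j (p + q - l))) =
     (\<Sum>l\<in>int ` {a..b+a}. ibinom i p * (ibinom (i - p) (l - p) * ibinom j (p + q - l)))"
    by (rule trans[OF sum.cong[OF refl *] sum.mono_neutral_cong_right]) (auto simp: ab)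
  also have "\<dots> = (\<Sum>l=a..b+a. ibinom i p * (ibinom (i - p) (int l - p) * ibinom j (p + q - int l)))"
    by (simp add: sum.reindex)
  also have "\<dots> = (\<Sum>l=0..b. ibinom i p * ((of_int (i - p) gchoose l) * (of_int j gchoose (b - l))))"
  proof -
    have "ibinom (i - p) (int (l + a) - p) = of_int (i - p) gchoose l" for l
      by (simp add: ab ibinom_def)
    moreover have "ibinom j (p + q - int (l + a)) = of_int j gchoose (b - l)" if "l \<le> b" for l
      using that by (simp add: ab ibinom_def nat_diff_distrib')
    ultimately show ?thesis
      using sum.shift_bounds_cl_nat_ivl[of "\<lambda>l. ibinom i p * (ibinom (i - p) (int l - p) * ibinom j (p + q - int l))" 0 a b]
      by (simp cong: sum.cong_simp)
  qed
  also have "\<dots> = ibinom i p * (of_int (i - p) + of_int j gchoose b)"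
    by (simp only: sum_distrib_left[symmetric] gbinomial_Vandermonde)
  also have "(of_int (i - p) + of_int j gchoose b) = ibinom (i + j - p) q"
    by (simp add: ibinom_def ab add.commute add_diff_eq)
  finally show ?thesis .
qed

definition subst_kernel :: "int \<Rightarrow> int \<Rightarrow> complex" where
  "subst_kernel i p = ibinom i (i - p)"

text \<open>The coefficient of \<open>x_0^p z^(i-p)\<close> in the difference of the two expansions
  of \<open>(z+x_0)^i\<close>. Symmetry of binomials makes it vanish for \<open>i \<ge> 0\<close>,
  so only negative powers of \<open>x\<close> contribute, as in a residue.\<close>

definition res_kernel :: "int \<Rightarrow> int \<Rightarrow> complex" where
  "res_kernel i p = ibinom i p - ibinom i (i - p)"

lemma res_kernel_nonneg: "0 \<le> i \<Longrightarrow> res_kernel i p = 0"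
  by (simp add: res_kernel_def ibinom_symmetric)

text \<open>The left side is the coefficient of \<open>x^t\<close> in \<open>(-z+x)^n\<close>, which
  the residue pairs with \<open>x^(-1-t)\<close>. Only one of the two terms of
  \<open>res_kernel\<close> is alive: the second for \<open>n \<ge> 0\<close>, the first for
  \<open>n < 0\<close>; negating the upper index identifies it.\<close>

lemma res_kernel_eq:
  "(of_int n gchoose t) * (-1) powi (n - int t) = - res_kernel (-1 - int t) (- n - 1)"
proof (cases "n \<ge> 0")
  case True
  define N where "N = nat n"
  with True have n: "n = int N" by simp
  show ?thesis
  proof (cases "t \<le> N")
    case True
    then have "ibinom (-1 - int t) (int (N - t)) = (-1) ^ (N - t) * ibinom (int N) (int (N - t))"
      using ibinom_negate[of "-1 - int t" "N - t"] by (simp add: of_nat_diff)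
    also have "ibinom (int N) (int (N - t)) = of_int n gchoose t"
      using ibinom_symmetric[of "int N" "int t"] True by (simp add: of_nat_diff ibinom_of_nat n)
    finally show ?thesis
      using True by (simp add: res_kernel_def n of_nat_diff power_int_def mult.commute nat_diff_distrib')
  next
    case False
    then show ?thesis
      using ibinom_eq_0[of n "int t"] by (simp add: n res_kernel_def ibinom_of_nat)
  qed
next
  case False
  define s where "s = nat (- n - 1)"
  with False have n: "n = - int s - 1" by simp
  have "ibinom (-1 - int t) (int s) = (-1) ^ s * ibinom (int (s + t)) (int s)"
    using ibinom_negate[of "-1 - int t" s] by simp
  moreover have "of_int n gchoose t = (-1) ^ t * ibinom (int (s + t)) (int t)"
    using ibinom_negate[of n t] by (simp add: n algebra_simps ibinom_def)
  moreover have "ibinom (int (s + t)) (int t) = ibinom (int (s + t)) (int s)"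
    using ibinom_symmetric[of "int (s + t)" "int s"] by simp
  moreover have "(-1 :: complex) powi (n - int t) = - ((-1) ^ s * (-1) ^ t)"
  proof -
    have "n - int t = - int (s + t + 1)"
      by (simp add: n)
    then have "(-1 :: complex) powi (n - int t) = inverse ((-1) ^ (s + t + 1))"
      by (simp only: power_int_minus power_int_of_nat)
    then show ?thesis
      by (simp add: power_add flip: power_inverse)
  qed
  moreover have "res_kernel (-1 - int t) (- n - 1) = ibinom (-1 - int t) (int s)"
    by (simp add: res_kernel_def n)
  ultimately show ?thesis
    by (simp add: mult.left_commute flip: power_mult_distrib)
qed

subsection \<open>Two-variable series and kernels\<close>

text \<open>
  \<open>F i m\<close> is the coefficient of \<open>x^i z^m\<close>; the operators below multiply \<open>F\<close> by \<open>x\<close>, \<open>x-z\<close>, \<open>x+z\<close>.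
\<close>

definition mulx :: "(int \<Rightarrow> int \<Rightarrow> 'w) \<Rightarrow> int \<Rightarrow> int \<Rightarrow> 'w" where
  "mulx F i m = F (i - 1) m"

definition mul_diff :: "(int \<Rightarrow> int \<Rightarrow> 'w::ab_group_add) \<Rightarrow> int \<Rightarrow> int \<Rightarrow> 'w" where
  "mul_diff F i m = F (i - 1) m - F i (m - 1)"

definition mul_sum :: "(int \<Rightarrow> int \<Rightarrow> 'w::ab_group_add) \<Rightarrow> int \<Rightarrow> int \<Rightarrow> 'w" where
  "mul_sum F i m = F (i - 1) m + F i (m - 1)"

definition lower2 :: "int \<Rightarrow> (int \<Rightarrow> int \<Rightarrow> 'w::ab_group_add) \<Rightarrow> bool" where
  "lower2 N F \<longleftrightarrow> (\<forall>i m. i < N \<or> m < N \<longrightarrow> F i m = 0)"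

definition laurent2 :: "(int \<Rightarrow> int \<Rightarrow> 'w::ab_group_add) \<Rightarrow> bool" where
  "laurent2 F \<longleftrightarrow> (\<exists>N. lower2 N F)"

lemma laurent2_mulx: "laurent2 F \<Longrightarrow> laurent2 (mulx F)"
  unfolding laurent2_def lower2_def mulx_def
  by (smt (verit))

lemma laurent2_shift: "laurent2 F \<Longrightarrow> laurent2 (\<lambda>i m. F i (m - 1))"
  unfolding laurent2_def lower2_def
  by (smt (verit))

lemma laurent2_add:
  assumes "laurent2 F" "laurent2 G"
  shows "laurent2 (\<lambda>i m. F i m + G i m)"
proof -
  obtain M N where "lower2 M F" "lower2 N G" using assms by (auto simp: laurent2_def)
  then have "lower2 (min M N) (\<lambda>i m. F i m + G i m)"
    by (auto simp: lower2_def)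
  then show ?thesis by (auto simp: laurent2_def)
qed

lemma laurent2_diff:
  assumes "laurent2 F" "laurent2 G"
  shows "laurent2 (\<lambda>i m. F i m - G i m)"
proof -
  obtain M N where "lower2 M F" "lower2 N G" using assms by (auto simp: laurent2_def)
  then have "lower2 (min M N) (\<lambda>i m. F i m - G i m)"
    by (auto simp: lower2_def)
  then show ?thesis by (auto simp: laurent2_def)
qed

lemma laurent2_mul_diff: "laurent2 F \<Longrightarrow> laurent2 (mul_diff F)"
  using laurent2_diff[OF laurent2_mulx laurent2_shift]
  by (simp add: mul_diff_def[abs_def] mulx_def)

lemma laurent2_mul_diff_pow: "laurent2 F \<Longrightarrow> laurent2 ((mul_diff ^^ k) F)"
  by (induction k) (auto simp: laurent2_mul_diff)

lemma mulx_pow: "(mulx ^^ k) F i m = F (i - int k) m"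
  by (induction k arbitrary: i) (auto simp: mulx_def algebra_simps)

lemma mul_diff_add: "mul_diff (\<lambda>i m. F i m + G i m) = (\<lambda>i m. mul_diff F i m + mul_diff G i m)"
  by (auto simp: mul_diff_def fun_eq_iff)

lemma mul_diff_pow_add:
  "(mul_diff ^^ k) (\<lambda>i m. F i m + G i m) = (\<lambda>i m. (mul_diff ^^ k) F i m + (mul_diff ^^ k) G i m)"
  by (induction k) (auto simp: mul_diff_add)

lemma laurent2_single_power:
  assumes "\<And>m. m < N \<Longrightarrow> f m = 0"
  shows "laurent2 (\<lambda>i m. if i = 0 then f m else 0)" and "laurent2 (\<lambda>i m. if m = 0 then f i else 0)"
  using assms unfolding laurent2_def lower2_def by (auto intro!: exI[of _ "min N 0"])

text \<open>
  A Pascal kernel is what turns multiplication by \<open>x\<close> into multiplication by \<open>x_0+z\<close> in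
  \<open>kernel_sum\<close> below, and hence multiplication by \<open>x-z\<close> into multiplication by \<open>x_0\<close>.
\<close>

definition Pascal_kernel :: "(int \<Rightarrow> int \<Rightarrow> complex) \<Rightarrow> bool" where
  "Pascal_kernel g \<longleftrightarrow> (\<forall>i p. g (i + 1) p = g i (p - 1) + g i p)"

text \<open>Finiteness may come from \<open>F\<close> or from the kernel: a lower bound on the
  powers of \<open>z\<close> is enough for \<open>subst_kernel\<close>, and one on the powers of
  \<open>x\<close> for \<open>res_kernel\<close>. The condition has to be tracked because
  \<open>Sum_any\<close> silently returns 0 on infinite support.\<close>

definition summable_against :: "(int \<Rightarrow> int \<Rightarrow> complex) \<Rightarrow> (int \<Rightarrow> int \<Rightarrow> 'w::ab_group_add) \<Rightarrow> bool" where
  "summable_against g F \<longleftrightarrow> (\<forall>p q. finite {i. g i p \<noteq> 0 \<and> F i (p + q - i) \<noteq> 0})"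

lemma summable_against_mulx:
  assumes "Pascal_kernel g" "summable_against g F"
  shows "summable_against g (mulx F)"
  unfolding summable_against_def
proof (intro allI)
  fix p q
  let ?A = "\<lambda>p q. {i. g i p \<noteq> 0 \<and> F i (p + q - i) \<noteq> 0}"
  have "{i. g i p \<noteq> 0 \<and> mulx F i (p + q - i) \<noteq> 0} \<subseteq> (\<lambda>i. i + 1) ` (?A (p - 1) q \<union> ?A p (q - 1))"
  proof
    fix i assume i: "i \<in> {i. g i p \<noteq> 0 \<and> mulx F i (p + q - i) \<noteq> 0}"
    have "g i p = g (i - 1) (p - 1) + g (i - 1) p"
      using assms(1) unfolding Pascal_kernel_def by (metis diff_add_cancel)
    with i have "i - 1 \<in> ?A (p - 1) q \<union> ?A p (q - 1)"
      by (auto simp: mulx_def algebra_simps)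
    then show "i \<in> (\<lambda>i. i + 1) ` (?A (p - 1) q \<union> ?A p (q - 1))"
      by (rule image_eqI[rotated]) simp
  qed
  moreover have "finite (?A p q)" for p q
    using assms(2) by (simp add: summable_against_def)
  ultimately show "finite {i. g i p \<noteq> 0 \<and> mulx F i (p + q - i) \<noteq> 0}"
    by (meson finite_UnI finite_imageI finite_subset)
qed

lemma summable_against_shift:
  "summable_against g F \<Longrightarrow> summable_against g (\<lambda>i m. F i (m - 1))"
  unfolding summable_against_def
proof (intro allI)
  fix p q
  assume "\<forall>p q. finite {i. g i p \<noteq> 0 \<and> F i (p + q - i) \<noteq> 0}"
  then have "finite {i. g i p \<noteq> 0 \<and> F i (p + (q - 1) - i) \<noteq> 0}"
    by blast
  then show "finite {i. g i p \<noteq> 0 \<and> F i (p + q - i - 1) \<noteq> 0}"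
    by (simp add: algebra_simps)
qed

lemma summable_against_diff:
  assumes "summable_against g F" "summable_against g G"
  shows "summable_against g (\<lambda>i m. F i m - G i m)"
  unfolding summable_against_def
proof (intro allI)
  fix p q
  show "finite {i. g i p \<noteq> 0 \<and> F i (p + q - i) - G i (p + q - i) \<noteq> 0}"
    by (rule finite_subset[of _ "{i. g i p \<noteq> 0 \<and> F i (p + q - i) \<noteq> 0} \<union> {i. g i p \<noteq> 0 \<and> G i (p + q - i) \<noteq> 0}"])
      (use assms in \<open>auto simp: summable_against_def\<close>)
qed

lemma summable_against_mul_diff:
  assumes "Pascal_kernel g" "summable_against g F"
  shows "summable_against g (mul_diff F)"
  using summable_against_diff[OF summable_against_mulx[OF assms] summable_against_shift[OF assms(2)]]
  by (simp add: mul_diff_def[abs_def] mulx_def)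

lemma Pascal_kernel_ibinom: "Pascal_kernel ibinom"
  by (simp add: Pascal_kernel_def ibinom_Pascal)

lemma Pascal_kernel_subst: "Pascal_kernel subst_kernel"
  unfolding Pascal_kernel_def subst_kernel_def
proof (intro allI)
  fix i p
  show "ibinom (i + 1) (i + 1 - p) = ibinom i (i - (p - 1)) + ibinom i (i - p)"
    using ibinom_Pascal[of i "i + 1 - p"] by (simp add: algebra_simps)
qed

lemma Pascal_kernel_res: "Pascal_kernel res_kernel"
  using Pascal_kernel_ibinom Pascal_kernel_subst
  by (simp add: Pascal_kernel_def res_kernel_def subst_kernel_def)

lemma summable_against_lower2: "lower2 N F \<Longrightarrow> summable_against g F"
  unfolding summable_against_def
proof (intro allI)
  fix p q assume F: "lower2 N F"
  have "i \<in> {N..p + q - N}" if "F i (p + q - i) \<noteq> 0" for i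
  proof -
    have "\<not> i < N" "\<not> p + q - i < N"
      using that F by (auto simp: lower2_def)
    then show ?thesis by simp
  qed
  then have "{i. g i p \<noteq> 0 \<and> F i (p + q - i) \<noteq> 0} \<subseteq> {N..p + q - N}"
    by blast
  then show "finite {i. g i p \<noteq> 0 \<and> F i (p + q - i) \<noteq> 0}"
    by (rule finite_subset) simp
qed

lemma summable_against_laurent2: "laurent2 F \<Longrightarrow> summable_against g F"
  by (auto simp: laurent2_def summable_against_lower2)

lemma summable_against_subst:
  assumes "\<And>i m. m < N \<Longrightarrow> F i m = 0"
  shows "summable_against subst_kernel F"
  unfolding summable_against_def
proof (intro allI)
  fix p q
  have "i \<in> {p..p + q - N}" if "subst_kernel i p \<noteq> 0" "F i (p + q - i) \<noteq> 0" for i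
  proof -
    have "\<not> p + q - i < N" "\<not> i < p"
      using that assms by (auto simp: subst_kernel_def)
    then show ?thesis by simp
  qed
  then have "{i. subst_kernel i p \<noteq> 0 \<and> F i (p + q - i) \<noteq> 0} \<subseteq> {p..p + q - N}"
    by blast
  then show "finite {i. subst_kernel i p \<noteq> 0 \<and> F i (p + q - i) \<noteq> 0}"
    by (rule finite_subset) simp
qed

lemma summable_against_res:
  assumes "\<And>i m. i < N \<Longrightarrow> F i m = 0"
  shows "summable_against res_kernel F"
  unfolding summable_against_def
proof (intro allI)
  fix p q
  have "i \<in> {N..0}" if "res_kernel i p \<noteq> 0" "F i (p + q - i) \<noteq> 0" for i
  proof -
    have "\<not> i < N" "\<not> 0 \<le> i"
      using that assms res_kernel_nonneg by auto
    then show ?thesis by simp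
  qed
  then have "{i. res_kernel i p \<noteq> 0 \<and> F i (p + q - i) \<noteq> 0} \<subseteq> {N..0}"
    by blast
  then show "finite {i. res_kernel i p \<noteq> 0 \<and> F i (p + q - i) \<noteq> 0}"
    by (rule finite_subset) simp
qed

text \<open>Turns sums over a natural expansion index \<open>t\<close> into sums over integer
  exponents, so that different expansions share one index set and can be added.\<close>

lemma Sum_any_inj_reindex:
  fixes f :: "'b \<Rightarrow> 'c::comm_monoid_add"
  assumes "inj h" "\<And>x. x \<notin> range h \<Longrightarrow> f x = 0"
  shows "Sum_any (\<lambda>t. f (h t)) = Sum_any f"
proof -
  have "x \<in> h ` {t. f (h t) \<noteq> 0}" if "f x \<noteq> 0" for x
  proof -
    have "x \<in> range h"
      using that by (rule contrapos_np) (rule assms(2))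
    then obtain t where "x = h t" ..
    with that show ?thesis by simp
  qed
  then have "{x. f x \<noteq> 0} = h ` {t. f (h t) \<noteq> 0}"
    by auto
  moreover have "inj_on h {t. f (h t) \<noteq> 0}"
    using assms(1) by (rule inj_on_subset) simp
  ultimately show ?thesis
    by (simp add: Sum_any.expand_set sum.reindex)
qed

lemma range_int_add: "range (\<lambda>t::nat. p + int t) = {p..}"
proof -
  have "x \<in> range (\<lambda>t::nat. p + int t)" if "p \<le> x" for x
    using that by (intro image_eqI[of _ _ "nat (x - p)"]) auto
  then show ?thesis by auto
qed

lemma range_int_diff: "range (\<lambda>t::nat. p - int t) = {..p}"
proof -
  have "x \<in> range (\<lambda>t::nat. p - int t)" if "x \<le> p" for x
    using that by (intro image_eqI[of _ _ "nat (p - x)"]) auto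
  then show ?thesis by auto
qed

locale complex_space = vector_space sc
  for sc :: "complex \<Rightarrow> 'w::ab_group_add \<Rightarrow> 'w"
begin

text \<open>
  As a series in \<open>x_0\<close> and \<open>z\<close>, \<open>kernel_sum g F\<close> is \<open>F(z+x_0,z)\<close> for \<open>g = ibinom\<close>, \<open>F(x_0+z,z)\<close> for
  \<open>g = subst_kernel\<close>, and for \<open>g = res_kernel\<close> its coefficient of \<open>x_0^p\<close> is the
  residue of \<open>-(-z+x)^(-p-1) F(x,z)\<close> with respect to \<open>x\<close>.
\<close>

definition kernel_sum :: "(int \<Rightarrow> int \<Rightarrow> complex) \<Rightarrow> (int \<Rightarrow> int \<Rightarrow> 'w) \<Rightarrow> int \<Rightarrow> int \<Rightarrow> 'w" where
  "kernel_sum g F p q = Sum_any (\<lambda>i. sc (g i p) (F i (p + q - i)))"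

lemma summable_againstD:
  fixes g :: "int \<Rightarrow> int \<Rightarrow> complex"
  shows "summable_against g F \<Longrightarrow> finite {i::int. sc (g i p) (F i (p + q - i)) \<noteq> 0}"
  unfolding summable_against_def
  by (rule finite_subset[of _ "{i. g i p \<noteq> 0 \<and> F i (p + q - i) \<noteq> 0}"]) auto

lemma kernel_sum_add:
  assumes "summable_against g F" "summable_against g G"
  shows "kernel_sum g (\<lambda>i m. F i m + G i m) p q = kernel_sum g F p q + kernel_sum g G p q"
  unfolding kernel_sum_def
  unfolding scale_right_distrib by (intro Sum_any.distrib summable_againstD assms)

lemma kernel_sum_diff:
  assumes "summable_against g F" "summable_against g G"
  shows "kernel_sum g (\<lambda>i m. F i m - G i m) p q = kernel_sum g F p q - kernel_sum g G p q"
proof -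
  have "kernel_sum g F p q = kernel_sum g (\<lambda>i m. (F i m - G i m) + G i m) p q"
    by simp
  also have "\<dots> = kernel_sum g (\<lambda>i m. F i m - G i m) p q + kernel_sum g G p q"
    by (rule kernel_sum_add) (use assms summable_against_diff in auto)
  finally show ?thesis by simp
qed

lemma kernel_sum_shift: "kernel_sum g (\<lambda>i m. F i (m - 1)) p q = kernel_sum g F p (q - 1)"
  unfolding kernel_sum_def by (simp add: algebra_simps)

lemma kernel_sum_mulx:
  assumes "Pascal_kernel g" "summable_against g F"
  shows "kernel_sum g (mulx F) p q = kernel_sum g F (p - 1) q + kernel_sum g F p (q - 1)"
proof -
  have "kernel_sum g (mulx F) p q = Sum_any (\<lambda>i. sc (g (i + 1) p) (F i (p + q - 1 - i)))"
    unfolding kernel_sum_def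
    by (rule Sum_any.reindex_cong[where l = "\<lambda>i. i + 1"])
      (auto simp: mulx_def fun_eq_iff algebra_simps intro!: o_bij[where g = "\<lambda>i. i - 1"])
  also have "\<dots> = Sum_any (\<lambda>i. sc (g i (p - 1)) (F i (p - 1 + q - i)) + sc (g i p) (F i (p + (q - 1) - i)))"
    using assms(1) by (simp add: Pascal_kernel_def scale_left_distrib algebra_simps)
  finally show ?thesis
    unfolding kernel_sum_def by (simp only: Sum_any.distrib summable_againstD[OF assms(2)])
qed

lemma kernel_sum_mul_diff:
  assumes "Pascal_kernel g" "summable_against g F"
  shows "kernel_sum g (mul_diff F) p q = kernel_sum g F (p - 1) q"
proof -
  have "kernel_sum g (mul_diff F) p q = kernel_sum g (\<lambda>i m. mulx F i m - F i (m - 1)) p q"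
    by (simp add: mul_diff_def[abs_def] mulx_def)
  then show ?thesis
    by (simp add: kernel_sum_diff summable_against_mulx summable_against_shift assms
        kernel_sum_mulx kernel_sum_shift)
qed

lemma kernel_sum_mul_diff_pow:
  assumes "Pascal_kernel g" "summable_against g F"
  shows "kernel_sum g ((mul_diff ^^ k) F) p q = kernel_sum g F (p - int k) q
    \<and> summable_against g ((mul_diff ^^ k) F)"
  using assms
  by (induction k arbitrary: p)
    (auto simp: kernel_sum_mul_diff summable_against_mul_diff algebra_simps)

lemma kernel_sum_res:
  assumes "summable_against ibinom F" "summable_against subst_kernel F"
  shows "kernel_sum res_kernel F p q = kernel_sum ibinom F p q - kernel_sum subst_kernel F p q"
proof -
  have "summable_against res_kernel F"
    unfolding summable_against_def
  proof (intro allI)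
    fix p q
    show "finite {i. res_kernel i p \<noteq> 0 \<and> F i (p + q - i) \<noteq> 0}"
      by (rule finite_subset[of _ "{i. ibinom i p \<noteq> 0 \<and> F i (p + q - i) \<noteq> 0}
            \<union> {i. subst_kernel i p \<noteq> 0 \<and> F i (p + q - i) \<noteq> 0}"])
        (use assms in \<open>auto simp: summable_against_def res_kernel_def subst_kernel_def\<close>)
  qed
  then have "kernel_sum res_kernel F p q + kernel_sum subst_kernel F p q
      = Sum_any (\<lambda>i. sc (res_kernel i p) (F i (p + q - i)) + sc (subst_kernel i p) (F i (p + q - i)))"
    unfolding kernel_sum_def
    by (intro Sum_any.distrib[symmetric] summable_againstD assms)
  also have "\<dots> = kernel_sum ibinom F p q"
    unfolding kernel_sum_def scale_left_distrib[symmetric] by (simp add: res_kernel_def subst_kernel_def)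
  finally show ?thesis by (simp add: algebra_simps)
qed

section \<open>Binomial factors as iterated difference operators and as kernel sums\<close>

definition binom_sum :: "complex \<Rightarrow> complex \<Rightarrow> int \<Rightarrow> (nat \<Rightarrow> 'w) \<Rightarrow> 'w" where
  "binom_sum c d n r = Sum_any (\<lambda>t::nat. sc ((of_int n gchoose t) * c powi (n - int t) * d ^ t) (r t))"

text \<open>Pascal's rule, term by term. It needs a finite range of \<open>t\<close>: for
  \<open>n \<ge> 0\<close> the binomials vanish beyond \<open>n\<close>, otherwise the family
  \<open>r\<close> has to end.\<close>

lemma binom_sum_Suc:
  assumes "c \<noteq> 0" and fin: "0 \<le> n \<or> (\<exists>M. \<forall>t>M. r t = 0)"
  shows "binom_sum c d (n + 1) r = sc c (binom_sum c d n r) + sc d (binom_sum c d n (\<lambda>t. r (Suc t)))"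
proof -
  define A where "A n t = (of_int n gchoose t) * c powi (n - int t) * d ^ t" for n t
  have A0: "A (n + 1) 0 = c * A n 0"
    using \<open>c \<noteq> 0\<close> by (simp add: A_def power_int_add)
  have AS: "A (n + 1) (Suc t) = c * A n (Suc t) + d * A n t" for t
  proof -
    have "c powi (n - int t) = c * c powi (n - int (Suc t))"
      using \<open>c \<noteq> 0\<close> power_int_add[of c 1 "n - int (Suc t)"] by simp
    moreover have "of_int (n + 1) gchoose Suc t = (of_int n gchoose t) + (of_int n gchoose Suc t :: complex)"
      using gbinomial_Suc_Suc[of "of_int n :: complex" t] by simp
    ultimately show ?thesis
      by (simp add: A_def del: of_int_add) (simp add: algebra_simps)
  qed
  obtain M where M: "\<And>n' t. n' = n \<or> n' = n + 1 \<Longrightarrow> t > M \<Longrightarrow> A n' t = 0 \<or> r t = 0"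
    "\<And>t. t > M \<Longrightarrow> A n t = 0 \<or> r (Suc t) = 0"
  proof (cases "0 \<le> n")
    case True
    then have "A n' t = 0" if "n' = n \<or> n' = n + 1" "t > nat n + 1" for n' t
    proof -
      have "0 \<le> n'" "n' < int t"
        using that True by linarith+
      then show ?thesis
        using ibinom_eq_0[of n' "int t"] by (simp add: A_def ibinom_of_nat)
    qed
    then show ?thesis using that[of "nat n + 1"] by blast
  next
    case False
    then obtain M where "\<forall>t>M. r t = 0" using fin by blast
    then show ?thesis using that[of M] by simp
  qed
  have eq: "Sum_any (\<lambda>t. sc (A n' t) (s t)) = (\<Sum>t\<le>K. sc (A n' t) (s t))"
    if "\<And>t. t > K \<Longrightarrow> A n' t = 0 \<or> s t = 0" for n' s K
    by (rule Sum_any.expand_superset) (use that in \<open>auto simp: not_le[symmetric]\<close>)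
  have "binom_sum c d (n + 1) r = (\<Sum>t\<le>Suc M. sc (A (n + 1) t) (r t))"
    unfolding binom_sum_def A_def[symmetric] by (rule eq) (use M in auto)
  also have "\<dots> = sc (A (n + 1) 0) (r 0) + (\<Sum>t\<le>M. sc (A (n + 1) (Suc t)) (r (Suc t)))"
    by (rule sum.atMost_Suc_shift)
  also have "\<dots> = (sc c (sc (A n 0) (r 0)) + (\<Sum>t\<le>M. sc c (sc (A n (Suc t)) (r (Suc t)))))
      + (\<Sum>t\<le>M. sc d (sc (A n t) (r (Suc t))))"
    by (simp add: A0 AS scale_left_distrib sum.distrib add.assoc)
  also have "\<dots> = sc c (\<Sum>t\<le>Suc M. sc (A n t) (r t)) + sc d (\<Sum>t\<le>M. sc (A n t) (r (Suc t)))"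
    unfolding sum.atMost_Suc_shift[of _ M] by (simp add: scale_right_distrib scale_sum_right)
  also have "(\<Sum>t\<le>Suc M. sc (A n t) (r t)) = binom_sum c d n r"
    unfolding binom_sum_def A_def[symmetric] by (rule eq[symmetric]) (use M in auto)
  also have "(\<Sum>t\<le>M. sc (A n t) (r (Suc t))) = binom_sum c d n (\<lambda>t. r (Suc t))"
    unfolding binom_sum_def A_def[symmetric] by (rule eq[symmetric]) (use M in auto)
  finally show ?thesis .
qed

lemma binom_mult_conv_binom_sum:
  "binom_mult sc c i d j n f e
    = binom_sum c d n (\<lambda>t. f (e[i := e ! i - (n - int t), j := e ! j - int t]))"
  by (simp add: binom_mult_def binom_sum_def)

lemma binom_mult_0: "binom_mult sc c i d j 0 f e = f e"
proof -
  have "binom_mult sc c i d j 0 f e = Sum_any (\<lambda>t::nat. if t = 0 then f e else 0)"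
    unfolding binom_mult_def by (rule Sum_any.cong) (auto simp: gbinomial_0_left)
  then show ?thesis by simp
qed

lemma binom_mult_Suc:
  assumes "c \<noteq> 0" "i \<noteq> j" "i < length e" "j < length e"
  shows "binom_mult sc c i d j (int (Suc k)) f e =
     sc c (binom_mult sc c i d j (int k) f (e[i := e ! i - 1]))
     + sc d (binom_mult sc c i d j (int k) f (e[j := e ! j - 1]))"
proof -
  let ?r = "\<lambda>t. f (e[i := e ! i - (int (Suc k) - int t), j := e ! j - int t])"
  have "binom_mult sc c i d j (int (Suc k)) f e = binom_sum c d (int k + 1) ?r"
    by (simp add: binom_mult_conv_binom_sum add.commute)
  also have "\<dots> = sc c (binom_sum c d (int k) ?r) + sc d (binom_sum c d (int k) (\<lambda>t. ?r (Suc t)))"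
    by (rule binom_sum_Suc) (use assms in auto)
  also have "binom_sum c d (int k) ?r = binom_mult sc c i d j (int k) f (e[i := e ! i - 1])"
    using assms by (simp add: binom_mult_conv_binom_sum algebra_simps)
  also have "binom_sum c d (int k) (\<lambda>t. ?r (Suc t)) = binom_mult sc c i d j (int k) f (e[j := e ! j - 1])"
    using assms by (simp add: binom_mult_conv_binom_sum list_update_swap[of i j] algebra_simps)
  finally show ?thesis .
qed

lemma binom_mult_mul_diff:
  "binom_mult sc 1 0 (-1) 1 (int k) f [i, m] = (mul_diff ^^ k) (\<lambda>i m. f [i, m]) i m"
proof (induction k arbitrary: i m)
  case (Suc k)
  show ?case
    using Suc by (simp add: binom_mult_Suc mul_diff_def del: of_nat_Suc)
qed (simp add: binom_mult_0)

lemma binom_mult_mul_sum: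
  "binom_mult sc 1 0 1 1 (int k) f [i, m] = (mul_sum ^^ k) (\<lambda>i m. f [i, m]) i m"
proof (induction k arbitrary: i m)
  case (Suc k)
  show ?case
    using Suc by (simp add: binom_mult_Suc mul_sum_def del: of_nat_Suc)
qed (simp add: binom_mult_0)

text \<open>The expansion of \<open>(-z+x)^n\<close> is infinite in \<open>x\<close>, but the lower
  bound on the powers of \<open>x\<close> in \<open>f\<close> leaves finitely many terms in each
  coefficient. Repeated, this lets \<open>(x-z)^k\<close> cancel the factor
  \<open>(-z+x)^(-k)\<close> of \<open>T_op\<close>.\<close>

lemma mul_diff_binom_mult_neg:
  assumes "\<And>i m. i < N \<Longrightarrow> f [i, m] = 0"
  shows "mul_diff (\<lambda>i m. binom_mult sc (-1) 1 1 0 n f [i, m]) i m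
     = binom_mult sc (-1) 1 1 0 (n + 1) f [i, m]"
proof -
  let ?r = "\<lambda>t. f [i - int t, m - (n + 1 - int t)]"
  have "binom_mult sc (-1) 1 1 0 (n + 1) f [i, m] = binom_sum (-1) 1 (n + 1) ?r"
    by (simp add: binom_mult_conv_binom_sum)
  also have "\<dots> = sc (-1) (binom_sum (-1) 1 n ?r) + sc 1 (binom_sum (-1) 1 n (\<lambda>t. ?r (Suc t)))"
  proof (rule binom_sum_Suc)
    have "?r t = 0" if "t > nat (i - N)" for t
      using that by (intro assms) linarith
    then show "0 \<le> n \<or> (\<exists>M. \<forall>t>M. ?r t = 0)" by blast
  qed simp
  also have "\<dots> = binom_sum (-1) 1 n (\<lambda>t. ?r (Suc t)) - binom_sum (-1) 1 n ?r"
    by simp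
  finally show ?thesis
    by (simp add: mul_diff_def binom_mult_conv_binom_sum algebra_simps)
qed

lemma mul_diff_pow_binom_mult_neg:
  assumes "\<And>i m. i < N \<Longrightarrow> f [i, m] = 0"
  shows "(mul_diff ^^ k) (\<lambda>i m. binom_mult sc (-1) 1 1 0 n f [i, m])
     = (\<lambda>i m. binom_mult sc (-1) 1 1 0 (n + int k) f [i, m])"
proof (induction k)
  case (Suc k)
  have "mul_diff (\<lambda>i m. binom_mult sc (-1) 1 1 0 (n + int k) f [i, m])
      = (\<lambda>i m. binom_mult sc (-1) 1 1 0 (n + int k + 1) f [i, m])"
    by (intro ext mul_diff_binom_mult_neg) (fact assms)
  then show ?case
    unfolding funpow.simps o_apply Suc by (simp only: of_nat_Suc add.assoc add.commute[of 1])
qed simp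

lemma binom_mult_neg_lower:
  assumes "\<And>i m. i < N \<Longrightarrow> f [i, m] = 0" "i < N"
  shows "binom_mult sc (-1) 1 1 0 n f [i, m] = 0"
  using assms by (simp add: binom_mult_def)

text \<open>Here \<open>- n - 1\<close> is the exponent of \<open>x_0\<close> attached to the
  \<open>n\<close>-th product. The residue pairs the \<open>t\<close>-th term with the exponent
  \<open>i = - n - 1 + t\<close>, and negating the upper index turns \<open>(-1)^t\<close> times the
  binomial into \<open>ibinom i t\<close>.\<close>

lemma binom_mult_subst:
  "binom_mult sc 1 0 (-1) 1 n f [-1, m] = kernel_sum subst_kernel (\<lambda>i m. f [i, m]) (- n - 1) m"
proof -
  let ?f = "\<lambda>i. sc (subst_kernel i (- n - 1)) (f [i, - n - 1 + m - i])"
  have "binom_mult sc 1 0 (-1) 1 n f [-1, m] = Sum_any (\<lambda>t. ?f (- n - 1 + int t))"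
    unfolding binom_mult_def
  proof (rule Sum_any.cong)
    fix t
    have "(of_int n gchoose t) * (-1) ^ t = subst_kernel (- n - 1 + int t) (- n - 1)"
      using ibinom_negate[of n t]
      by (simp add: subst_kernel_def ibinom_of_nat algebra_simps flip: power_mult_distrib)
    then show "sc ((of_int n gchoose t) * 1 powi (n - int t) * (-1) ^ t)
         (f ([-1, m][0 := [-1, m] ! 0 - (n - int t), 1 := [-1, m] ! 1 - int t]))
        = ?f (- n - 1 + int t)"
      by (simp add: algebra_simps)
  qed
  also have "\<dots> = Sum_any ?f"
    by (rule Sum_any_inj_reindex)
      (auto simp: range_int_add subst_kernel_def intro!: injI)
  finally show ?thesis by (simp add: kernel_sum_def)
qed

lemma binom_mult_res:
  "binom_mult sc (-1) 1 1 0 n f [-1, m] = - kernel_sum res_kernel (\<lambda>i m. f [i, m]) (- n - 1) m"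
proof -
  let ?f = "\<lambda>i. sc (- res_kernel i (- n - 1)) (f [i, - n - 1 + m - i])"
  have "binom_mult sc (-1) 1 1 0 n f [-1, m] = Sum_any (\<lambda>t. ?f (- 1 - int t))"
    unfolding binom_mult_def by (rule Sum_any.cong) (simp add: res_kernel_eq algebra_simps)
  also have "\<dots> = Sum_any ?f"
    by (rule Sum_any_inj_reindex)
      (auto simp: range_int_diff res_kernel_nonneg intro!: injI)
  also have "\<dots> = - Sum_any (\<lambda>i. sc (res_kernel i (- n - 1)) (f [i, - n - 1 + m - i]))"
    by (simp add: Sum_any.expand_set sum_negf)
  finally show ?thesis by (simp add: kernel_sum_def)
qed

lemma subst_sum_conv_kernel_sum:
  "subst_sum sc f [p, q] = kernel_sum subst_kernel (\<lambda>i m. f [i, m]) p q"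
proof -
  let ?f = "\<lambda>i. sc (subst_kernel i p) (f [i, p + q - i])"
  have "subst_sum sc f [p, q] = Sum_any (\<lambda>t. ?f (p + int t))"
    unfolding subst_sum_def
    by (rule Sum_any.cong) (simp add: subst_kernel_def ibinom_of_nat)
  also have "\<dots> = Sum_any ?f"
    by (rule Sum_any_inj_reindex)
      (auto simp: range_int_add subst_kernel_def intro!: injI)
  finally show ?thesis by (simp add: kernel_sum_def)
qed

end

subsection \<open>Three-variable series\<close>

text \<open>The indices in \<open>mul12\<close>, \<open>mul13\<close>, \<open>mul23\<close> number the variables \<open>x,y,z\<close> whose difference is the factor.\<close>

definition mul12 :: "(int \<Rightarrow> int \<Rightarrow> int \<Rightarrow> 'w::ab_group_add) \<Rightarrow> int \<Rightarrow> int \<Rightarrow> int \<Rightarrow> 'w" where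
  "mul12 H i j m = H (i - 1) j m - H i (j - 1) m"

definition mul13 :: "(int \<Rightarrow> int \<Rightarrow> int \<Rightarrow> 'w::ab_group_add) \<Rightarrow> int \<Rightarrow> int \<Rightarrow> int \<Rightarrow> 'w" where
  "mul13 H i j m = H (i - 1) j m - H i j (m - 1)"

definition mul23 :: "(int \<Rightarrow> int \<Rightarrow> int \<Rightarrow> 'w::ab_group_add) \<Rightarrow> int \<Rightarrow> int \<Rightarrow> int \<Rightarrow> 'w" where
  "mul23 H i j m = H i (j - 1) m - H i j (m - 1)"

lemma mul12_mul13: "mul12 (mul13 H) = mul13 (mul12 H)"
  and mul12_mul23: "mul12 (mul23 H) = mul23 (mul12 H)"
  and mul13_mul23: "mul13 (mul23 H) = mul23 (mul13 H)"
  by (simp_all add: mul12_def mul13_def mul23_def fun_eq_iff)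

lemma funpow_commute:
  assumes "\<And>x. f (g x) = g (f x)"
  shows "(f ^^ a) ((g ^^ b) x) = (g ^^ b) ((f ^^ a) x)"
proof -
  have *: "f ((g ^^ b) x) = (g ^^ b) (f x)" for x
    by (induction b) (simp_all add: assms)
  show ?thesis
    by (induction a) (simp_all add: *)
qed

lemma mul23_pow: "(mul23 ^^ k) H i = (mul_diff ^^ k) (H i)"
  by (induction k) (simp_all add: mul23_def mul_diff_def fun_eq_iff)

lemma mul12_pow: "(mul12 ^^ k) H i j m = (mul_diff ^^ k) (\<lambda>i j. H i j m) i j"
  by (induction k arbitrary: i j) (simp_all add: mul12_def mul_diff_def)

definition lower3 :: "int \<Rightarrow> (int \<Rightarrow> int \<Rightarrow> int \<Rightarrow> 'w::zero) \<Rightarrow> bool" where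
  "lower3 N G \<longleftrightarrow> (\<forall>i j m. i < N \<or> j < N \<or> m < N \<longrightarrow> G i j m = 0)"

lemma lower3_mul12: "lower3 N H \<Longrightarrow> lower3 N (mul12 H)"
  and lower3_mul23: "lower3 N H \<Longrightarrow> lower3 N (mul23 H)"
  by (auto simp: lower3_def mul12_def mul23_def)

lemma lower3_mul12_pow: "lower3 N H \<Longrightarrow> lower3 N ((mul12 ^^ k) H)"
  by (induction k) (simp_all add: lower3_mul12)

lemma lower3_mul23_pow: "lower3 N H \<Longrightarrow> lower3 N ((mul23 ^^ k) H)"
  by (induction k) (simp_all add: lower3_mul23)

lemma mul_sum_pow_translate:
  "(mul_sum ^^ k) (\<lambda>p q. F (p - a) (q - b)) p q = (mul_sum ^^ k) F (p - a) (q - b)"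
  by (induction k arbitrary: p q) (simp_all add: mul_sum_def diff_diff_eq add_ac)

lemma laurent2_mul12: "(\<And>i. laurent2 (H i)) \<Longrightarrow> laurent2 (mul12 H i)"
  using laurent2_diff[OF _ laurent2_mulx, of "H (i - 1)" "H i"]
  by (simp add: mul12_def[abs_def] mulx_def)

lemma laurent2_mul13: "(\<And>i. laurent2 (H i)) \<Longrightarrow> laurent2 (mul13 H i)"
  using laurent2_diff[OF _ laurent2_shift, of "H (i - 1)" "H i"]
  by (simp add: mul13_def[abs_def])

lemma laurent2_mul23':
  "(\<And>m. laurent2 (\<lambda>i j. H i j m)) \<Longrightarrow> laurent2 (\<lambda>i j. mul23 H i j m)"
  using laurent2_diff[OF laurent2_shift[of "\<lambda>i j. H i j m"], of "\<lambda>i j. H i j (m - 1)"]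
  by (simp add: mul23_def[abs_def])

lemma laurent2_mul13':
  "(\<And>m. laurent2 (\<lambda>i j. H i j m)) \<Longrightarrow> laurent2 (\<lambda>i j. mul13 H i j m)"
  using laurent2_diff[OF laurent2_mulx[of "\<lambda>i j. H i j m"], of "\<lambda>i j. H i j (m - 1)"]
  by (simp add: mul13_def[abs_def] mulx_def)

lemma laurent2_mul13_pow: "(\<And>i. laurent2 (H i)) \<Longrightarrow> laurent2 ((mul13 ^^ b) H i)"
  by (induction b arbitrary: i) (simp_all add: laurent2_mul13)

lemma laurent2_mul12_pow: "(\<And>i. laurent2 (H i)) \<Longrightarrow> laurent2 ((mul12 ^^ b) H i)"
  by (induction b arbitrary: i) (simp_all add: laurent2_mul12)

lemma laurent2_mul23_pow':
  "(\<And>m. laurent2 (\<lambda>i j. H i j m)) \<Longrightarrow> laurent2 (\<lambda>i j. (mul23 ^^ b) H i j m)"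
  by (induction b arbitrary: m) (simp_all add: laurent2_mul23')

lemma laurent2_mul13_pow':
  "(\<And>m. laurent2 (\<lambda>i j. H i j m)) \<Longrightarrow> laurent2 (\<lambda>i j. (mul13 ^^ b) H i j m)"
  by (induction b arbitrary: m) (simp_all add: laurent2_mul13')

text \<open>
  Here \<open>R q\<close> is the coefficient of \<open>t^q\<close> in a series in \<open>t,x,z\<close>; the factors are \<open>x-z-t\<close> and \<open>x-z+t\<close>.
\<close>

definition fam_diff :: "(int \<Rightarrow> int \<Rightarrow> int \<Rightarrow> 'w::ab_group_add) \<Rightarrow> int \<Rightarrow> int \<Rightarrow> int \<Rightarrow> 'w" where
  "fam_diff R q i m = mul_diff (R q) i m - R (q - 1) i m"

definition fam_sum :: "(int \<Rightarrow> int \<Rightarrow> int \<Rightarrow> 'w::ab_group_add) \<Rightarrow> int \<Rightarrow> int \<Rightarrow> int \<Rightarrow> 'w" where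
  "fam_sum R q i m = mul_diff (R q) i m + R (q - 1) i m"

context complex_space
begin

text \<open>The total degree is a separate \<open>c\<close> so that nested sums of equal total
  degree get literally the same summands and can be interchanged as finite sums.\<close>

lemma kernel_sum_window:
  assumes "finite A" "p + q = c" "\<And>i. i \<notin> A \<Longrightarrow> g i p = 0 \<or> F i (c - i) = 0"
  shows "kernel_sum g F p q = (\<Sum>i\<in>A. sc (g i p) (F i (c - i)))"
  unfolding kernel_sum_def assms(2)
proof (rule Sum_any.expand_superset[OF assms(1)])
  have "sc (g i p) (F i (c - i)) = 0" if "i \<notin> A" for i
    using assms(3)[OF that] by auto
  then show "{i. sc (g i p) (F i (c - i)) \<noteq> 0} \<subseteq> A"
    by blast
qed

text \<open>As all exponents of \<open>G\<close> are bounded below, a fixed coefficient involves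
  finitely many monomials. On each of them the claim is
  \<open>ibinom_trinomial_Vandermonde\<close>.\<close>

lemma subst_taylor_taylor:
  assumes "lower3 N G"
  shows "kernel_sum subst_kernel
      (\<lambda>p q. kernel_sum ibinom (\<lambda>i m. kernel_sum ibinom (G i) q m) p m) p q
    = kernel_sum ibinom (\<lambda>j m. kernel_sum ibinom (\<lambda>i j. G i j m) p j) q m"
proof -
  \<comment> \<open>The three exponents add up to \<open>m + p + q\<close> and each is at least
    \<open>N\<close>, so none exceeds \<open>U\<close>.\<close>
  define U where "U = m + p + q - 2 * N"
  have zero: "G i j m' = 0" if "i < N \<or> j < N \<or> m' < N" for i j m'
    using assms that unfolding lower3_def by blast
  have taylor1: "kernel_sum ibinom (G i) q' (m + p' - i)
      = (\<Sum>j=N..U. sc (ibinom j q') (G i j (m + p + q - i - j)))" if "p' + q' = p + q" for i p' q'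
  proof (rule kernel_sum_window)
    fix j assume j: "j \<notin> {N..U}"
    have "i < N \<or> j < N \<or> m + p + q - i - j < N"
      using j by (simp add: U_def) linarith
    then show "ibinom j q' = 0 \<or> G i j (m + p + q - i - j) = 0"
      using zero by blast
  qed (use that in simp_all)
  have taylor2: "kernel_sum ibinom (\<lambda>i m. kernel_sum ibinom (G i) q' m) p' m
      = (\<Sum>i=N..U. \<Sum>j=N..U. sc (ibinom i p' * ibinom j q') (G i j (m + p + q - i - j)))"
    if eq: "p' + q' = p + q" for p' q'
  proof -
    have "kernel_sum ibinom (\<lambda>i m. kernel_sum ibinom (G i) q' m) p' m
      = (\<Sum>i=N..U. sc (ibinom i p') (kernel_sum ibinom (G i) q' (m + p' - i)))"
    proof (rule kernel_sum_window)
      fix i assume i: "i \<notin> {N..U}"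
      have "G i j (m + p + q - i - j) = 0" for j
      proof (rule zero)
        show "i < N \<or> j < N \<or> m + p + q - i - j < N"
          using i by (simp add: U_def) linarith
      qed
      then have "kernel_sum ibinom (G i) q' (m + p' - i) = 0"
        unfolding taylor1[OF eq] by simp
      then show "ibinom i p' = 0 \<or> kernel_sum ibinom (G i) q' (m + p' - i) = 0" ..
    qed simp_all
    then show ?thesis
      unfolding taylor1[OF eq] by (simp add: scale_sum_right)
  qed
  define L where "L l = (\<Sum>i=N..U. \<Sum>j=N..U.
      sc (ibinom i l * ibinom j (p + q - l)) (G i j (m + p + q - i - j)))" for l
  have L: "kernel_sum ibinom (\<lambda>i m. kernel_sum ibinom (G i) (p + q - l) m) l m = L l" for l
    unfolding L_def by (rule taylor2) simp
  have "kernel_sum subst_kernel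
      (\<lambda>p q. kernel_sum ibinom (\<lambda>i m. kernel_sum ibinom (G i) q m) p m) p q
    = (\<Sum>l=0..p+q. sc (subst_kernel l p)
        (kernel_sum ibinom (\<lambda>i m. kernel_sum ibinom (G i) (p + q - l) m) l m))"
  proof (rule kernel_sum_window)
    fix l assume "l \<notin> {0..p+q}"
    then have "l < 0 \<or> p + q - l < 0"
      by auto
    then have "L l = 0"
      unfolding L_def by auto
    then show "subst_kernel l p = 0
        \<or> kernel_sum ibinom (\<lambda>i m. kernel_sum ibinom (G i) (p + q - l) m) l m = 0"
      unfolding L by simp
  qed simp_all
  also have "\<dots> = (\<Sum>l=0..p+q. sc (subst_kernel l p) (L l))"
    by (simp only: L)
  also have "\<dots> = (\<Sum>i=N..U. \<Sum>j=N..U. \<Sum>l=0..p+q.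
      sc (ibinom l (l - p) * (ibinom i l * ibinom j (p + q - l))) (G i j (m + p + q - i - j)))"
    unfolding L_def scale_sum_right subst_kernel_def scale_scale
    by (subst sum.swap, rule sum.cong[OF refl], subst sum.swap, rule refl)
  also have "\<dots> = (\<Sum>i=N..U. \<Sum>j=N..U. sc (ibinom i p * ibinom (i + j - p) q) (G i j (m + p + q - i - j)))"
    by (simp only: scale_sum_left[symmetric] ibinom_trinomial_Vandermonde)
  finally have lhs: "kernel_sum subst_kernel
      (\<lambda>p q. kernel_sum ibinom (\<lambda>i m. kernel_sum ibinom (G i) q m) p m) p q
    = (\<Sum>i=N..U. \<Sum>j=N..U. sc (ibinom i p * ibinom (i + j - p) q) (G i j (m + p + q - i - j)))" .
  \<comment> \<open>After \<open>x = y+x_0\<close> the exponent of \<open>y\<close> is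
    \<open>i + j - p\<close> with \<open>i\<close> and \<open>j\<close> in \<open>{N..U}\<close>.
    This window is independent of \<open>i\<close>, so the sums can be swapped before it is cut down
    for each \<open>i\<close>.\<close>
  define W where "W = {2 * N - p..2 * U - p}"
  have inner: "kernel_sum ibinom (\<lambda>i j'. G i j' (q + m - j)) p j
      = (\<Sum>i=N..U. sc (ibinom i p) (G i (p + j - i) (q + m - j)))" for j
  proof (rule kernel_sum_window)
    fix i assume i: "i \<notin> {N..U}"
    have "i < N \<or> p + j - i < N \<or> q + m - j < N"
      using i by (simp add: U_def) linarith
    then show "ibinom i p = 0 \<or> G i (p + j - i) (q + m - j) = 0"
      using zero by blast
  qed simp_all
  have "kernel_sum ibinom (\<lambda>j m. kernel_sum ibinom (\<lambda>i j. G i j m) p j) q m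
    = (\<Sum>j\<in>W. sc (ibinom j q) (kernel_sum ibinom (\<lambda>i j'. G i j' (q + m - j)) p j))"
  proof (rule kernel_sum_window)
    fix j assume j: "j \<notin> W"
    have "G i (p + j - i) (q + m - j) = 0" if i: "i \<in> {N..U}" for i
    proof (rule zero)
      show "i < N \<or> p + j - i < N \<or> q + m - j < N"
        using i j by (simp add: U_def W_def) linarith
    qed
    then have "kernel_sum ibinom (\<lambda>i j'. G i j' (q + m - j)) p j = 0"
      unfolding inner by simp
    then show "ibinom j q = 0 \<or> kernel_sum ibinom (\<lambda>i j'. G i j' (q + m - j)) p j = 0" ..
  qed (simp_all add: W_def)
  also have "\<dots> = (\<Sum>j\<in>W. \<Sum>i=N..U. sc (ibinom i p * ibinom j q) (G i (p + j - i) (q + m - j)))"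
    unfolding inner scale_sum_right scale_scale by (simp only: mult.commute)
  also have "\<dots> = (\<Sum>i=N..U. \<Sum>j\<in>W. sc (ibinom i p * ibinom j q) (G i (p + j - i) (q + m - j)))"
    by (rule sum.swap)
  also have "\<dots> = (\<Sum>i=N..U. \<Sum>j=N..U. sc (ibinom i p * ibinom (i + j - p) q) (G i j (m + p + q - i - j)))"
  proof (rule sum.cong[OF refl])
    fix i assume i: "i \<in> {N..U}"
    have "(\<Sum>j\<in>W. sc (ibinom i p * ibinom j q) (G i (p + j - i) (q + m - j)))
        = (\<Sum>j\<in>{N + i - p..U + i - p}. sc (ibinom i p * ibinom j q) (G i (p + j - i) (q + m - j)))"
    proof (rule sum.mono_neutral_right)
      show "{N + i - p..U + i - p} \<subseteq> W"
        using i by (auto simp: W_def)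
      show "\<forall>j\<in>W - {N + i - p..U + i - p}. sc (ibinom i p * ibinom j q) (G i (p + j - i) (q + m - j)) = 0"
      proof
        fix j assume j: "j \<in> W - {N + i - p..U + i - p}"
        have "i < N \<or> p + j - i < N \<or> q + m - j < N"
          using i j by (simp add: U_def) linarith
        then have "G i (p + j - i) (q + m - j) = 0"
          by (rule zero)
        then show "sc (ibinom i p * ibinom j q) (G i (p + j - i) (q + m - j)) = 0"
          by simp
      qed
    qed (simp add: W_def)
    also have "\<dots> = (\<Sum>j=N..U. sc (ibinom i p * ibinom (i + j - p) q) (G i j (m + p + q - i - j)))"
      by (rule sum.reindex_bij_witness[of _ "\<lambda>j. i + j - p" "\<lambda>j. p + j - i"])
        (auto simp: add_diff_eq diff_diff_eq add_ac)
    finally show "(\<Sum>j\<in>W. sc (ibinom i p * ibinom j q) (G i (p + j - i) (q + m - j)))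
        = (\<Sum>j=N..U. sc (ibinom i p * ibinom (i + j - p) q) (G i j (m + p + q - i - j)))" .
  qed
  finally show ?thesis
    by (simp only: lhs)
qed

text \<open>
  \<open>expands R Z\<close> says that \<open>x_0^L Z(x_0,z)\<close> is \<open>(x-z)^L R(x,z)\<close> at \<open>x = z+x_0\<close>. For
  \<open>R = a(x)b(z)w\<close> it determines \<open>Z = Y_E(a,x_0)b(z)w\<close>, and it is compatible with sums and with
  multiplication by \<open>x-z\<close>, so that no residue has to be computed again.
\<close>

definition expands :: "(int \<Rightarrow> int \<Rightarrow> 'w) \<Rightarrow> (int \<Rightarrow> int \<Rightarrow> 'w) \<Rightarrow> bool" where
  "expands R Z \<longleftrightarrow> (\<exists>L. laurent2 ((mul_diff ^^ L) R) \<and>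
     (\<forall>p m. Z p m = kernel_sum ibinom ((mul_diff ^^ L) R) (p + int L) m))"

lemma taylor_raise:
  assumes "laurent2 ((mul_diff ^^ k) R)" "k \<le> l"
  shows "laurent2 ((mul_diff ^^ l) R)"
    and "kernel_sum ibinom ((mul_diff ^^ l) R) (p + int l) m = kernel_sum ibinom ((mul_diff ^^ k) R) (p + int k) m"
proof -
  have eq: "(mul_diff ^^ l) R = (mul_diff ^^ (l - k)) ((mul_diff ^^ k) R)"
    using assms(2) by (simp flip: funpow_add o_apply[of "mul_diff ^^ _"])
  show "laurent2 ((mul_diff ^^ l) R)"
    unfolding eq by (rule laurent2_mul_diff_pow) fact
  have "kernel_sum ibinom ((mul_diff ^^ l) R) (p + int l) m
      = kernel_sum ibinom ((mul_diff ^^ k) R) (p + int l - int (l - k)) m"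
    unfolding eq
    using kernel_sum_mul_diff_pow[OF Pascal_kernel_ibinom summable_against_laurent2[OF assms(1)]] by blast
  then show "kernel_sum ibinom ((mul_diff ^^ l) R) (p + int l) m
      = kernel_sum ibinom ((mul_diff ^^ k) R) (p + int k) m"
    using assms(2) by (simp add: of_nat_diff)
qed

lemma expandsE:
  assumes "expands R Z"
  obtains L where "\<And>l. L \<le> l \<Longrightarrow> laurent2 ((mul_diff ^^ l) R)"
    "\<And>l p m. L \<le> l \<Longrightarrow> Z p m = kernel_sum ibinom ((mul_diff ^^ l) R) (p + int l) m"
proof -
  obtain L where L: "laurent2 ((mul_diff ^^ L) R)"
    "\<And>p m. Z p m = kernel_sum ibinom ((mul_diff ^^ L) R) (p + int L) m"
    using assms by (auto simp: expands_def)
  show ?thesis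
  proof (rule that[of L])
    show "laurent2 ((mul_diff ^^ l) R)" if "L \<le> l" for l
      using L(1) that by (rule taylor_raise)
    show "Z p m = kernel_sum ibinom ((mul_diff ^^ l) R) (p + int l) m" if "L \<le> l" for l p m
      unfolding L(2) using L(1) that by (rule taylor_raise(2)[symmetric])
  qed
qed

lemma expandsI:
  assumes "laurent2 ((mul_diff ^^ L) R)"
    "\<And>p m. Z p m = kernel_sum ibinom ((mul_diff ^^ L) R) (p + int L) m"
  shows "expands R Z"
  using assms by (auto simp: expands_def)

lemma expands_unique:
  assumes "expands R Z" "expands R Z'"
  shows "Z = Z'"
proof (intro ext)
  fix p m
  obtain L where L: "\<And>l p m. L \<le> l \<Longrightarrow> Z p m = kernel_sum ibinom ((mul_diff ^^ l) R) (p + int l) m"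
    using assms(1) by (rule expandsE) blast
  obtain L' where L': "\<And>l p m. L' \<le> l \<Longrightarrow> Z' p m = kernel_sum ibinom ((mul_diff ^^ l) R) (p + int l) m"
    using assms(2) by (rule expandsE) blast
  show "Z p m = Z' p m"
    using L[of "max L L'" p m] L'[of "max L L'" p m] by simp
qed

lemma expands_add:
  assumes "expands R Z" "expands R' Z'"
  shows "expands (\<lambda>i m. R i m + R' i m) (\<lambda>p m. Z p m + Z' p m)"
proof -
  obtain L where L: "\<And>l. L \<le> l \<Longrightarrow> laurent2 ((mul_diff ^^ l) R)"
    "\<And>l p m. L \<le> l \<Longrightarrow> Z p m = kernel_sum ibinom ((mul_diff ^^ l) R) (p + int l) m"
    using assms(1) by (rule expandsE) blast
  obtain L' where L': "\<And>l. L' \<le> l \<Longrightarrow> laurent2 ((mul_diff ^^ l) R')"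
    "\<And>l p m. L' \<le> l \<Longrightarrow> Z' p m = kernel_sum ibinom ((mul_diff ^^ l) R') (p + int l) m"
    using assms(2) by (rule expandsE) blast
  let ?l = "max L L'"
  have "laurent2 ((mul_diff ^^ ?l) R)" "laurent2 ((mul_diff ^^ ?l) R')"
    by (simp_all add: L L')
  then show ?thesis
    by (intro expandsI[of ?l])
      (simp_all add: mul_diff_pow_add laurent2_add kernel_sum_add summable_against_laurent2
        L(2)[of ?l] L'(2)[of ?l])
qed

lemma mul_diff_scale: "mul_diff (\<lambda>i m. sc c (R i m)) = (\<lambda>i m. sc c (mul_diff R i m))"
  by (simp add: mul_diff_def fun_eq_iff scale_right_diff_distrib)

lemma mul_diff_pow_scale: "(mul_diff ^^ k) (\<lambda>i m. sc c (R i m)) = (\<lambda>i m. sc c ((mul_diff ^^ k) R i m))"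
  by (induction k) (simp_all add: mul_diff_scale)

lemma kernel_sum_scale:
  assumes "summable_against g F"
  shows "kernel_sum g (\<lambda>i m. sc c (F i m)) p q = sc c (kernel_sum g F p q)"
proof -
  let ?A = "{i. sc (g i p) (F i (p + q - i)) \<noteq> 0}"
  have "kernel_sum g (\<lambda>i m. sc c (F i m)) p q = (\<Sum>i\<in>?A. sc c (sc (g i p) (F i (p + q - i))))"
    unfolding kernel_sum_def
    by (subst Sum_any.expand_superset[OF summable_againstD[OF assms]]) (auto simp: mult.commute)
  then show ?thesis
    by (simp add: kernel_sum_def Sum_any.expand_set scale_sum_right)
qed

lemma expands_scale:
  assumes "expands R Z"
  shows "expands (\<lambda>i m. sc c (R i m)) (\<lambda>p m. sc c (Z p m))"
proof -
  obtain L where L: "\<And>l. L \<le> l \<Longrightarrow> laurent2 ((mul_diff ^^ l) R)"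
    "\<And>l p m. L \<le> l \<Longrightarrow> Z p m = kernel_sum ibinom ((mul_diff ^^ l) R) (p + int l) m"
    using assms(1) by (rule expandsE) blast
  obtain N where N: "lower2 N ((mul_diff ^^ L) R)"
    using L(1)[of L] by (auto simp: laurent2_def)
  then have "laurent2 (\<lambda>i m. sc c ((mul_diff ^^ L) R i m))"
    by (auto simp: laurent2_def lower2_def)
  then show ?thesis
    by (intro expandsI[of L])
      (simp_all add: mul_diff_pow_scale L(2)[of L] kernel_sum_scale summable_against_laurent2 L(1))
qed

lemma expands_diff:
  assumes "expands R Z" "expands R' Z'"
  shows "expands (\<lambda>i m. R i m - R' i m) (\<lambda>p m. Z p m - Z' p m)"
  using expands_add[OF assms(1) expands_scale[OF assms(2), of "-1"]] by simp

lemma expands_taylor: "laurent2 R \<Longrightarrow> expands R (kernel_sum ibinom R)"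
  by (rule expandsI[of 0]) simp_all

lemma expands_mul_diff:
  assumes "expands R Z"
  shows "expands (mul_diff R) (mulx Z)"
proof -
  obtain L where L: "\<And>l. L \<le> l \<Longrightarrow> laurent2 ((mul_diff ^^ l) R)"
    "\<And>l p m. L \<le> l \<Longrightarrow> Z p m = kernel_sum ibinom ((mul_diff ^^ l) R) (p + int l) m"
    using assms(1) by (rule expandsE) blast
  show ?thesis
    by (rule expandsI[of L])
      (simp_all add: funpow_swap1[symmetric] L(1) L(2)[of L] laurent2_mul_diff mulx_def add_ac
        kernel_sum_mul_diff Pascal_kernel_ibinom summable_against_laurent2 add_diff_eq)
qed

section \<open>Taylor expansion of three-variable series in two stages\<close>

lemma kernel_sum_zero: "(\<And>i. F i (p + q - i) = 0) \<Longrightarrow> kernel_sum g F p q = 0"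
  by (simp add: kernel_sum_def)

text \<open>The power \<open>z^m\<close> next to \<open>x_2^q\<close> stems from
  \<open>y^j z^(q+m-j)\<close>, whence \<open>m \<ge> 2 * N - q\<close>. The bound moves with
  \<open>q\<close>, which is why series are expanded one coefficient of \<open>x_2\<close> at a
  time.\<close>

lemma laurent2_taylor12:
  assumes "lower3 N G"
  shows "laurent2 (\<lambda>i m. kernel_sum ibinom (G i) q m)"
proof -
  have "kernel_sum ibinom (G i) q m = 0" if im: "i < min N (2 * N - q) \<or> m < min N (2 * N - q)" for i m
  proof (rule kernel_sum_zero)
    fix j
    have "i < N \<or> j < N \<or> q + m - j < N"
      using im by linarith
    with assms show "G i j (q + m - j) = 0"
      unfolding lower3_def by blast
  qed
  then show ?thesis
    unfolding laurent2_def lower2_def by blast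
qed

lemma laurent2_taylor23:
  assumes "lower3 N G"
  shows "laurent2 (\<lambda>j m. kernel_sum ibinom (\<lambda>i j. G i j m) p j)"
proof -
  have "kernel_sum ibinom (\<lambda>i j. G i j m) p j = 0" if jm: "j < min N (2 * N - p) \<or> m < min N (2 * N - p)" for j m
  proof (rule kernel_sum_zero)
    fix i
    have "i < N \<or> p + j - i < N \<or> m < N"
      using jm by linarith
    with assms show "G i (p + j - i) m = 0"
      unfolding lower3_def by blast
  qed
  then show ?thesis
    unfolding laurent2_def lower2_def by blast
qed

lemma expands_mul_diff_pow:
  "expands R Z \<Longrightarrow> expands ((mul_diff ^^ k) R) (\<lambda>p. Z (p - int k))"
proof (induction k)
  case (Suc k)
  have "mulx (\<lambda>p. Z (p - int k)) = (\<lambda>p. Z (p - int (Suc k)))"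
    by (simp add: mulx_def fun_eq_iff diff_diff_eq)
  with expands_mul_diff[OF Suc.IH[OF Suc.prems]] show ?case by simp
qed simp

text \<open>At \<open>x = z+x_1\<close> the factor \<open>x-z-t\<close> becomes
  \<open>x_1-t\<close>: its part \<open>x-z\<close> shifts the exponent \<open>p\<close> of
  \<open>x_1\<close>, its part \<open>t\<close> the exponent \<open>q\<close> of the family.\<close>

lemma expands_fam_diff_pow:
  assumes "\<And>q. expands (R q) (Z q)"
  shows "expands ((fam_diff ^^ k) R q) (\<lambda>p m. (mul_diff ^^ k) (\<lambda>p q. Z q p m) p q)"
proof (induction k arbitrary: q)
  case (Suc k)
  show ?case
    using expands_diff[OF expands_mul_diff[OF Suc.IH[of q]] Suc.IH[of "q - 1"]]
    by (simp add: fam_diff_def[abs_def] mul_diff_def[abs_def] mulx_def[abs_def])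
qed (use assms in simp)

lemma expands_fam_sum_pow:
  assumes "\<And>p. expands (R p) (Z p)"
  shows "expands ((fam_sum ^^ k) R p) (\<lambda>q m. (mul_sum ^^ k) (\<lambda>p q. Z p q m) p q)"
proof (induction k arbitrary: p)
  case (Suc k)
  show ?case
    using expands_add[OF expands_mul_diff[OF Suc.IH[of p]] Suc.IH[of "p - 1"]]
    by (simp add: fam_sum_def[abs_def] mul_sum_def[abs_def] mulx_def[abs_def] add.commute)
qed (use assms in simp)

lemma taylor_mul12:
  assumes "\<And>i. laurent2 (H i)"
  shows "(\<lambda>q i m. kernel_sum ibinom (mul12 H i) q m) = fam_diff (\<lambda>q i m. kernel_sum ibinom (H i) q m)"
proof (intro ext)
  fix q i m
  have "mul12 H i = (\<lambda>j m. H (i - 1) j m - mulx (H i) j m)"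
    by (simp add: mul12_def mulx_def fun_eq_iff)
  then show "kernel_sum ibinom (mul12 H i) q m = fam_diff (\<lambda>q i m. kernel_sum ibinom (H i) q m) q i m"
    by (simp add: kernel_sum_diff kernel_sum_mulx summable_against_laurent2 laurent2_mulx assms
        Pascal_kernel_ibinom fam_diff_def mul_diff_def)
qed

lemma taylor_mul13:
  assumes "\<And>i. laurent2 (H i)"
  shows "(\<lambda>i m. kernel_sum ibinom (mul13 H i) q m) = mul_diff (\<lambda>i m. kernel_sum ibinom (H i) q m)"
proof (intro ext)
  fix i m
  have "mul13 H i = (\<lambda>j m. H (i - 1) j m - H i j (m - 1))"
    by (simp add: mul13_def fun_eq_iff)
  then show "kernel_sum ibinom (mul13 H i) q m = mul_diff (\<lambda>i m. kernel_sum ibinom (H i) q m) i m"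
    by (simp add: kernel_sum_diff kernel_sum_shift summable_against_laurent2 laurent2_shift assms mul_diff_def)
qed

text \<open>The primed variants substitute \<open>x = y+t\<close>, the unprimed ones \<open>y = z+t\<close>.\<close>

lemma taylor_mul23':
  assumes "\<And>m. laurent2 (\<lambda>i j. H i j m)"
  shows "(\<lambda>j m. kernel_sum ibinom (\<lambda>i j. mul23 H i j m) p j)
    = mul_diff (\<lambda>j m. kernel_sum ibinom (\<lambda>i j. H i j m) p j)"
proof (intro ext)
  fix j m
  show "kernel_sum ibinom (\<lambda>i j. mul23 H i j m) p j
      = mul_diff (\<lambda>j m. kernel_sum ibinom (\<lambda>i j. H i j m) p j) j m"
    unfolding mul23_def
    by (simp add: kernel_sum_diff kernel_sum_shift[of _ "\<lambda>i j. H i j m"] summable_against_laurent2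
        laurent2_shift[of "\<lambda>i j. H i j m"] assms mul_diff_def)
qed

lemma taylor_mul13':
  assumes "\<And>m. laurent2 (\<lambda>i j. H i j m)"
  shows "(\<lambda>p j m. kernel_sum ibinom (\<lambda>i j. mul13 H i j m) p j)
    = fam_sum (\<lambda>p j m. kernel_sum ibinom (\<lambda>i j. H i j m) p j)"
proof (intro ext)
  fix p j m
  have "(\<lambda>i j. mul13 H i j m) = (\<lambda>i j. mulx (\<lambda>i j. H i j m) i j - H i j (m - 1))"
    by (simp add: mul13_def mulx_def fun_eq_iff)
  then show "kernel_sum ibinom (\<lambda>i j. mul13 H i j m) p j
      = fam_sum (\<lambda>p j m. kernel_sum ibinom (\<lambda>i j. H i j m) p j) p j m"
    by (simp add: kernel_sum_diff kernel_sum_mulx summable_against_laurent2 laurent2_mulx assms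
        Pascal_kernel_ibinom fam_sum_def mul_diff_def)
qed

lemma taylor_mul12_pow:
  assumes "\<And>i. laurent2 (H i)"
  shows "(\<lambda>q i m. kernel_sum ibinom ((mul12 ^^ a) H i) q m)
    = (fam_diff ^^ a) (\<lambda>q i m. kernel_sum ibinom (H i) q m)"
  by (induction a) (simp_all add: taylor_mul12 laurent2_mul12_pow assms)

lemma taylor_mul13_pow:
  assumes "\<And>i. laurent2 (H i)"
  shows "(\<lambda>i m. kernel_sum ibinom ((mul13 ^^ b) H i) q m)
    = (mul_diff ^^ b) (\<lambda>i m. kernel_sum ibinom (H i) q m)"
  by (induction b) (simp_all add: taylor_mul13 laurent2_mul13_pow assms)

lemma taylor_mul23_pow':
  assumes "\<And>m. laurent2 (\<lambda>i j. H i j m)"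
  shows "(\<lambda>j m. kernel_sum ibinom (\<lambda>i j. (mul23 ^^ a) H i j m) p j)
    = (mul_diff ^^ a) (\<lambda>j m. kernel_sum ibinom (\<lambda>i j. H i j m) p j)"
  by (induction a) (simp_all add: taylor_mul23' laurent2_mul23_pow' assms)

lemma taylor_mul13_pow':
  assumes "\<And>m. laurent2 (\<lambda>i j. H i j m)"
  shows "(\<lambda>p j m. kernel_sum ibinom (\<lambda>i j. (mul13 ^^ b) H i j m) p j)
    = (fam_sum ^^ b) (\<lambda>p j m. kernel_sum ibinom (\<lambda>i j. H i j m) p j)"
  by (induction b) (simp_all add: taylor_mul13' laurent2_mul13_pow' assms)

text \<open>\<open>H\<close> is Laurent in \<open>y,z\<close> for each power of \<open>x\<close>
  separately, so its expansion at \<open>y = z+x_2\<close> may still have poles in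
  \<open>x-z\<close>. The factors \<open>(x-z)^b\<close> and \<open>(x-y)^a\<close> act on
  \<open>Z\<close> as \<open>x_1^b\<close> and \<open>(x_1-x_2)^a\<close>; once applied they give
  \<open>G\<close>, and uniqueness leaves only its Taylor expansion.\<close>

lemma iterated_expansion_right:
  assumes H: "\<And>i. laurent2 (H i)" and G: "lower3 N G" "G = (mul12 ^^ a) ((mul13 ^^ b) H)"
    and Z: "\<And>q. expands (\<lambda>i m. kernel_sum ibinom (H i) q m) (Z q)"
  shows "(mul_diff ^^ a) (\<lambda>p q. Z q (p - int b) m) p q
    = kernel_sum ibinom (\<lambda>i m. kernel_sum ibinom (G i) q m) p m"
proof -
  let ?R = "\<lambda>q i m. kernel_sum ibinom ((mul13 ^^ b) H i) q m"
  have R: "expands (?R q) (\<lambda>p. Z q (p - int b))" for q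
    using expands_mul_diff_pow[OF Z] by (simp add: taylor_mul13_pow H)
  have "(fam_diff ^^ a) ?R = (\<lambda>q i m. kernel_sum ibinom (G i) q m)"
    unfolding G(2) using taylor_mul12_pow[of "(mul13 ^^ b) H" a] by (simp add: laurent2_mul13_pow H)
  with expands_fam_diff_pow[where R = ?R and k = a and q = q, OF R]
  have "expands (\<lambda>i m. kernel_sum ibinom (G i) q m)
      (\<lambda>p m. (mul_diff ^^ a) (\<lambda>p q. Z q (p - int b) m) p q)"
    by simp
  from expands_unique[OF this expands_taylor[OF laurent2_taylor12[OF G(1)]]]
  show ?thesis by (rule fun_cong[THEN fun_cong])
qed

text \<open>With \<open>x = y+x_0\<close> substituted first, \<open>x-z\<close> turns into
  \<open>y-z+x_0\<close>, and \<open>y = z+x_2\<close> turns that into \<open>x_2+x_0\<close>. This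
  is the source of the factor \<open>(x_0+x_2)^b\<close> in weak associativity.\<close>

lemma iterated_expansion_left:
  assumes H: "\<And>m. laurent2 (\<lambda>i j. H i j m)" and G: "lower3 N G" "G = (mul13 ^^ b) ((mul23 ^^ a) H)"
    and Z: "\<And>p. expands (\<lambda>j m. kernel_sum ibinom (\<lambda>i j. H i j m) p j) (Z p)"
  shows "(mul_sum ^^ b) (\<lambda>p q. Z p (q - int a) m) p q
    = kernel_sum ibinom (\<lambda>j m. kernel_sum ibinom (\<lambda>i j. G i j m) p j) q m"
proof -
  let ?R = "\<lambda>p j m. kernel_sum ibinom (\<lambda>i j. (mul23 ^^ a) H i j m) p j"
  have R: "expands (?R p) (\<lambda>q. Z p (q - int a))" for p
    using expands_mul_diff_pow[OF Z] by (simp add: taylor_mul23_pow' H)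
  have "(fam_sum ^^ b) ?R = (\<lambda>p j m. kernel_sum ibinom (\<lambda>i j. G i j m) p j)"
    unfolding G(2) using taylor_mul13_pow'[of "(mul23 ^^ a) H" b] by (simp add: laurent2_mul23_pow' H)
  with expands_fam_sum_pow[where R = ?R and k = b and p = p, OF R]
  have "expands (\<lambda>j m. kernel_sum ibinom (\<lambda>i j. G i j m) p j)
      (\<lambda>q m. (mul_sum ^^ b) (\<lambda>p q. Z p (q - int a) m) p q)"
    by simp
  from expands_unique[OF this expands_taylor[OF laurent2_taylor23[OF G(1)]]]
  show ?thesis by (rule fun_cong[THEN fun_cong])
qed

lemma kernel_sum_mulx_pow:
  assumes "Pascal_kernel g" "summable_against g F"
  shows "kernel_sum g ((mulx ^^ l) F) p q = (mul_sum ^^ l) (kernel_sum g F) p q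
    \<and> summable_against g ((mulx ^^ l) F)"
  by (induction l arbitrary: p q)
    (simp_all add: kernel_sum_mulx summable_against_mulx assms mul_sum_def)

end

subsection \<open>Products of weak vertex operators\<close>

definition comp2 :: "('w \<Rightarrow> int \<Rightarrow> 'w) \<Rightarrow> ('w \<Rightarrow> int \<Rightarrow> 'w) \<Rightarrow> 'w \<Rightarrow> int \<Rightarrow> int \<Rightarrow> 'w" where
  "comp2 a b w i m = a (b w m) i"

lemma op_prod_2: "(\<lambda>i m. op_prod [a, b] w [i, m]) = comp2 a b w"
  by (simp add: comp2_def fun_eq_iff)

lemma Hom_laurent_2_laurent2:
  assumes "F \<in> Hom_laurent sc 2"
  shows "laurent2 (\<lambda>i m. F w [i, m])"
proof -
  obtain N where N: "\<And>e. length e = 2 \<and> (\<exists>i<2. e ! i < N) \<Longrightarrow> F w e = 0"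
    using assms unfolding Hom_laurent_def laurent_def by blast
  have "F w [i, m] = 0" if "i < N \<or> m < N" for i m
    by (rule N) (use that in \<open>auto intro: exI[of _ 0] exI[of _ 1]\<close>)
  then show ?thesis
    unfolding laurent2_def lower2_def by blast
qed

lemma Hom_laurent_3_lower3:
  assumes "F \<in> Hom_laurent sc 3"
  shows "\<exists>N. lower3 N (\<lambda>i j m. F w [i, j, m])"
proof -
  obtain N where N: "\<And>e. length e = 3 \<and> (\<exists>i<3. e ! i < N) \<Longrightarrow> F w e = 0"
    using assms unfolding Hom_laurent_def laurent_def by blast
  have "F w [i, j, m] = 0" if "i < N \<or> j < N \<or> m < N" for i j m
    by (rule N) (use that in \<open>auto intro: exI[of _ 0] exI[of _ 1] exI[of _ 2]\<close>)
  then show ?thesis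
    unfolding lower3_def by blast
qed

lemma E_G1_module_hom:
  assumes "a \<in> E_G1 sc"
  shows "module_hom sc sc (\<lambda>w. a w n)"
  using assms by (simp add: E_G1_def module_hom_iff_linear)

lemma E_G1_laurent1:
  assumes "a \<in> E_G1 sc"
  shows "laurent1 (a w)"
  using assms by (simp add: E_G1_def)

context complex_space
begin

lemma module_hom_kernel_sum:
  assumes "module_hom sc sc h" "summable_against g F"
  shows "h (kernel_sum g F p q) = kernel_sum g (\<lambda>i m. h (F i m)) p q"
proof -
  interpret module_hom sc sc h by fact
  let ?A = "{i. sc (g i p) (F i (p + q - i)) \<noteq> 0}"
  have "kernel_sum g (\<lambda>i m. h (F i m)) p q = (\<Sum>i\<in>?A. h (sc (g i p) (F i (p + q - i))))"
    unfolding kernel_sum_def scale[symmetric]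
    by (rule Sum_any.expand_superset[OF summable_againstD[OF assms(2)]]) auto
  then show ?thesis
    by (simp add: kernel_sum_def Sum_any.expand_set sum)
qed

lemma module_hom_mul_diff_pow:
  assumes "module_hom sc sc h"
  shows "h ((mul_diff ^^ k) F i m) = (mul_diff ^^ k) (\<lambda>i m. h (F i m)) i m"
proof -
  interpret module_hom sc sc h by fact
  show ?thesis
    by (induction k arbitrary: i m) (simp_all add: mul_diff_def diff)
qed

lemma laurent2_module_hom:
  assumes "module_hom sc sc h" "laurent2 F"
  shows "laurent2 (\<lambda>i m. h (F i m))"
proof -
  interpret module_hom sc sc h by fact
  show ?thesis
    using assms(2) unfolding laurent2_def lower2_def by (metis zero)
qed

lemma op_scale_complex_space: "complex_space (op_scale sc)"
  unfolding complex_space_def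
  by unfold_locales
    (simp_all add: op_scale_def fun_eq_iff scale_right_distrib scale_left_distrib)

text \<open>One \<open>k\<close> serves all \<open>w\<close>, since compatibility asks for a single
  exponent. From here on \<open>Y_E\<close> is handled through this formula and no longer through
  residues.\<close>

lemma Y_E_conv_taylor:
  assumes a: "a \<in> E_G1 sc" and b: "b \<in> E_G1 sc" and "compatible sc [a, b]"
  obtains k where "\<And>w. laurent2 ((mul_diff ^^ k) (comp2 a b w))"
    "\<And>w p m. Y_E sc a b p w m = kernel_sum ibinom ((mul_diff ^^ k) (comp2 a b w)) (p + int k) m"
proof -
  let ?P = "\<lambda>k::nat. (\<lambda>w. binom_mult sc 1 0 (-1) 1 (int k) (op_prod [a, b] w)) \<in> Hom_laurent sc 2"
  \<comment> \<open>The very choice made inside \<open>T_op\<close>, so that \<open>T_op\<close>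
    unfolds to an expression in this \<open>k\<close>.\<close>
  define k where "k = (SOME k. ?P k)"
  have "\<exists>k. ?P k"
    using assms(3) by (simp add: compatible_def numeral_2_eq_2)
  then have k: "?P k"
    unfolding k_def by (rule someI_ex)
  define f where "f w = binom_mult sc 1 0 (-1) 1 (int k) (op_prod [a, b] w)" for w
  have f: "(\<lambda>i m. f w [i, m]) = (mul_diff ^^ k) (comp2 a b w)" for w
    by (simp only: f_def binom_mult_mul_diff op_prod_2)
  have laurent: "laurent2 ((mul_diff ^^ k) (comp2 a b w))" for w
    using Hom_laurent_2_laurent2[OF k, of w] by (simp only: f f_def[symmetric])
  have T: "T_op sc a b w = binom_mult sc (-1) 1 1 0 (- int k) (f w)" for w
    by (simp add: T_op_def Let_def k_def f_def)
  have "Y_E sc a b p w m = kernel_sum ibinom ((mul_diff ^^ k) (comp2 a b w)) (p + int k) m" for w p m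
  proof -
    let ?F = "(mul_diff ^^ k) (comp2 a b w)" and ?T = "\<lambda>i m. T_op sc a b w [i, m]"
    obtain N where N: "lower2 N ?F"
      using laurent[of w] by (auto simp: laurent2_def)
    have fN: "f w [i, m] = 0" if "i < N" for i m
      using N that fun_cong[OF fun_cong[OF f[of w], of i], of m] by (simp add: lower2_def)
    \<comment> \<open>\<open>?T\<close> is \<open>(-z+x)^(-k)\<close> times \<open>?F\<close>, while \<open>a(x)b(z)w\<close> is \<open>(x-z)^(-k)\<close> times \<open>?F\<close>; hence both terms of
      the residue are kernel sums of \<open>?F\<close>, whose kernels add up to \<open>ibinom\<close>\<close>
    have "(mul_diff ^^ k) ?T = (\<lambda>i m. binom_mult sc (-1) 1 1 0 (- int k + int k) (f w) [i, m])"
      unfolding T by (rule mul_diff_pow_binom_mult_neg) (fact fN)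
    then have TF: "(mul_diff ^^ k) ?T = ?F"
      by (simp add: binom_mult_0 f)
    have "summable_against res_kernel ?T"
      unfolding T by (rule summable_against_res[of N], rule binom_mult_neg_lower[of N]) (use fN in simp_all)
    from kernel_sum_mul_diff_pow[OF Pascal_kernel_res this, of k "p + int k" m]
    have res: "kernel_sum res_kernel ?T p m = kernel_sum res_kernel ?F (p + int k) m"
      by (simp add: TF)
    obtain M where M: "\<And>m. m < M \<Longrightarrow> b w m = 0"
      using E_G1_laurent1[OF b, of w] by (auto simp: laurent1_def)
    \<comment> \<open>The lower bound on the powers of \<open>x\<close> in \<open>a(x)b(z)w\<close>
      may vary with the power of \<open>z\<close>; the truncation of \<open>b(z)w\<close> bounds
      \<open>z\<close>, and that suffices for this kernel.\<close>
    have "summable_against subst_kernel (comp2 a b w)"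
      by (rule summable_against_subst[of M])
        (simp add: comp2_def M module_hom.zero[OF E_G1_module_hom[OF a]])
    from kernel_sum_mul_diff_pow[OF Pascal_kernel_subst this, of k "p + int k" m]
    have subst: "kernel_sum subst_kernel (comp2 a b w) p m = kernel_sum subst_kernel ?F (p + int k) m"
      by simp
    have "Y_E sc a b p w m = kernel_sum subst_kernel (comp2 a b w) p m + kernel_sum res_kernel ?T p m"
      by (simp only: Y_E_def nth_prod_def binom_mult_subst binom_mult_res op_prod_2) simp
    also have "\<dots> = kernel_sum ibinom ?F (p + int k) m"
      using kernel_sum_res[OF summable_against_laurent2[OF laurent[of w]] summable_against_laurent2[OF laurent[of w]]]
      by (simp add: res subst)
    finally show ?thesis .
  qed
  with laurent show ?thesis by (rule that)
qed

end

lemma sum_fun_apply2: "sum f A w m = (\<Sum>a\<in>A. f a w m)"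
  for f :: "'c \<Rightarrow> 'a \<Rightarrow> 'b \<Rightarrow> 'd::comm_monoid_add"
  by (induction A rule: infinite_finite_induct) simp_all

context complex_space
begin

text \<open>Finiteness is required of the operators themselves: an infinite family may be finite at
  every \<open>w\<close>, and then \<open>Sum_any\<close> over operators would be 0 while its value
  at \<open>w\<close> need not be.\<close>

lemma op_scale_kernel_sum_apply:
  assumes "summable_against g F"
  shows "complex_space.kernel_sum (op_scale sc) g F p q w m = kernel_sum g (\<lambda>i j. F i j w m) p q"
proof -
  interpret ops: complex_space "op_scale sc"
    by (rule op_scale_complex_space)
  let ?A = "{i. g i p \<noteq> 0 \<and> F i (p + q - i) \<noteq> 0}"
  have fin: "finite ?A"
    using assms unfolding summable_against_def by blast
  have "ops.kernel_sum g F p q = (\<Sum>i\<in>?A. op_scale sc (g i p) (F i (p + q - i)))"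
    using fin by (rule ops.kernel_sum_window) auto
  then have "ops.kernel_sum g F p q w m = (\<Sum>i\<in>?A. sc (g i p) (F i (p + q - i) w m))"
    by (simp add: sum_fun_apply2 op_scale_def)
  also have "\<dots> = kernel_sum g (\<lambda>i j. F i j w m) p q"
    using fin by (rule kernel_sum_window[symmetric]) auto
  finally show ?thesis .
qed

lemma binom_mult_mul12:
  "binom_mult sc 1 0 (-1) 1 (int k) f [i, j, m] = (mul12 ^^ k) (\<lambda>i j m. f [i, j, m]) i j m"
proof (induction k arbitrary: i j m)
  case (Suc k)
  show ?case
    using Suc by (simp add: binom_mult_Suc mul12_def del: of_nat_Suc)
qed (simp add: binom_mult_0)

lemma binom_mult_mul13:
  "binom_mult sc 1 0 (-1) 2 (int k) f [i, j, m] = (mul13 ^^ k) (\<lambda>i j m. f [i, j, m]) i j m"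
proof (induction k arbitrary: i j m)
  case (Suc k)
  show ?case
    using Suc by (simp add: binom_mult_Suc mul13_def numeral_2_eq_2 del: of_nat_Suc)
qed (simp add: binom_mult_0)

lemma binom_mult_mul23:
  "binom_mult sc 1 1 (-1) 2 (int k) f [i, j, m] = (mul23 ^^ k) (\<lambda>i j m. f [i, j, m]) i j m"
proof (induction k arbitrary: i j m)
  case (Suc k)
  show ?case
    using Suc by (simp add: binom_mult_Suc mul23_def numeral_2_eq_2 del: of_nat_Suc)
qed (simp add: binom_mult_0)

end

definition comp3 :: "('w \<Rightarrow> int \<Rightarrow> 'w) \<Rightarrow> ('w \<Rightarrow> int \<Rightarrow> 'w) \<Rightarrow> ('w \<Rightarrow> int \<Rightarrow> 'w)
    \<Rightarrow> 'w \<Rightarrow> int \<Rightarrow> int \<Rightarrow> int \<Rightarrow> 'w" where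
  "comp3 a b c w i j m = a (b (c w m) j) i"

lemma op_prod_3: "(\<lambda>i j m. op_prod [a, b, c] w [i, j, m]) = comp3 a b c w"
  by (simp add: comp3_def fun_eq_iff)

subsection \<open>Spaces of compatible vertex operators\<close>

lemma mul_sum_pow_apply: "(mul_sum ^^ k) F p q w m = (mul_sum ^^ k) (\<lambda>p q. F p q w m) p q"
  by (induction k arbitrary: p q) (simp_all add: mul_sum_def)

locale vertex_operator_space = complex_space sc
  for sc :: "complex \<Rightarrow> 'w::ab_group_add \<Rightarrow> 'w" +
  fixes V :: "('w \<Rightarrow> int \<Rightarrow> 'w) set"
  assumes V_E_G1: "V \<subseteq> E_G1 sc"
    and V_subspace: "module.subspace (op_scale sc) V"
    and V_compatible: "\<And>\<psi>s. \<lbrakk>set \<psi>s \<subseteq> V; length \<psi>s = 2 \<or> length \<psi>s = 3\<rbrakk> \<Longrightarrow> compatible sc \<psi>s"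
    and id_in_V: "id_op \<in> V"
    and nth_prod_in_V: "\<And>\<psi> \<phi> n. \<lbrakk>\<psi> \<in> V; \<phi> \<in> V\<rbrakk> \<Longrightarrow> nth_prod sc \<psi> n \<phi> \<in> V"
begin

interpretation ops: complex_space "op_scale sc"
  by (rule op_scale_complex_space)

lemma mode_hom: "a \<in> V \<Longrightarrow> module_hom sc sc (\<lambda>w. a w n)"
  using V_E_G1 by (blast intro: E_G1_module_hom)

lemma mode_laurent1: "a \<in> V \<Longrightarrow> laurent1 (a w)"
  using V_E_G1 by (blast intro: E_G1_laurent1)

lemma mode_zero: "a \<in> V \<Longrightarrow> a 0 n = 0"
  by (rule module_hom.zero[OF mode_hom])

lemma V_plus: "a \<in> V \<Longrightarrow> b \<in> V \<Longrightarrow> a + b \<in> V"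
  using V_subspace by (rule ops.subspace_add)

lemma V_scale: "a \<in> V \<Longrightarrow> op_scale sc c a \<in> V"
  using V_subspace by (rule ops.subspace_scale)

lemma V_zero: "0 \<in> V"
  using V_subspace by (rule ops.subspace_0)

lemma Y_in_V: "a \<in> V \<Longrightarrow> b \<in> V \<Longrightarrow> Y_E sc a b p \<in> V"
  by (simp add: Y_E_def nth_prod_in_V)

section \<open>Expansion, bilinearity, truncation and vacuum properties of
  \<open>Y_E\<close>\<close>

lemma Y_E_taylor:
  assumes "a \<in> V" "b \<in> V"
  obtains k0 where "\<And>k w. k0 \<le> k \<Longrightarrow> laurent2 ((mul_diff ^^ k) (comp2 a b w))"
    "\<And>k w p m. k0 \<le> k \<Longrightarrow>
      Y_E sc a b p w m = kernel_sum ibinom ((mul_diff ^^ k) (comp2 a b w)) (p + int k) m"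
proof -
  have "compatible sc [a, b]"
    by (rule V_compatible) (use assms in auto)
  then obtain k0 where k0: "\<And>w. laurent2 ((mul_diff ^^ k0) (comp2 a b w))"
    "\<And>w p m. Y_E sc a b p w m = kernel_sum ibinom ((mul_diff ^^ k0) (comp2 a b w)) (p + int k0) m"
    using Y_E_conv_taylor V_E_G1 assms by (metis subsetD)
  show ?thesis
  proof (rule that)
    show "laurent2 ((mul_diff ^^ k) (comp2 a b w))" if "k0 \<le> k" for k w
      using k0(1) that by (rule taylor_raise)
    show "Y_E sc a b p w m = kernel_sum ibinom ((mul_diff ^^ k) (comp2 a b w)) (p + int k) m"
      if "k0 \<le> k" for k w p m
      unfolding k0(2) using k0(1) that by (rule taylor_raise(2)[symmetric])
  qed
qed

lemma Y_E_expands: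
  assumes "a \<in> V" "b \<in> V"
  shows "expands (comp2 a b w) (\<lambda>p. Y_E sc a b p w)"
proof -
  obtain k where k: "\<And>l w. k \<le> l \<Longrightarrow> laurent2 ((mul_diff ^^ l) (comp2 a b w))"
    "\<And>l w p m. k \<le> l \<Longrightarrow>
      Y_E sc a b p w m = kernel_sum ibinom ((mul_diff ^^ l) (comp2 a b w)) (p + int l) m"
    using assms by (rule Y_E_taylor) blast
  show ?thesis
    by (rule expandsI[of k]) (use k(1)[of k] k(2)[of k] in simp_all)
qed

text \<open>\<open>T_op\<close> chooses its \<open>k\<close> anew for each pair, which hides even
  bilinearity. Uniqueness of \<open>expands\<close> reduces such identities to the products
  \<open>a(x)b(z)w\<close>.\<close>

lemma Y_E_eqI:
  assumes "a \<in> V" "b \<in> V" "\<And>w. expands (comp2 a b w) (\<lambda>p m. Z p w m)"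
  shows "Y_E sc a b p = Z p"
proof (intro ext)
  fix w m
  from expands_unique[OF Y_E_expands[OF assms(1,2)] assms(3), of w]
  show "Y_E sc a b p w m = Z p w m"
    by (rule fun_cong[THEN fun_cong])
qed

lemma Y_E_add_left:
  assumes "a \<in> V" "a' \<in> V" "b \<in> V"
  shows "Y_E sc (a + a') b p = Y_E sc a b p + Y_E sc a' b p"
proof (rule Y_E_eqI)
  fix w
  show "expands (comp2 (a + a') b w) (\<lambda>p. (Y_E sc a b p + Y_E sc a' b p) w)"
    using expands_add[OF Y_E_expands[OF assms(1,3)] Y_E_expands[OF assms(2,3)], of w w]
    by (simp add: comp2_def[abs_def] plus_fun_def)
qed (simp_all only: assms V_plus)

lemma Y_E_scale_left:
  assumes "a \<in> V" "b \<in> V"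
  shows "Y_E sc (op_scale sc c a) b p = op_scale sc c (Y_E sc a b p)"
proof (rule Y_E_eqI)
  fix w
  show "expands (comp2 (op_scale sc c a) b w) (\<lambda>p. op_scale sc c (Y_E sc a b p) w)"
    using expands_scale[OF Y_E_expands[OF assms], of c w]
    by (simp add: comp2_def[abs_def] op_scale_def)
qed (use assms V_scale in auto)

lemma Y_E_add_right:
  assumes "a \<in> V" "b \<in> V" "b' \<in> V"
  shows "Y_E sc a (b + b') p = Y_E sc a b p + Y_E sc a b' p"
proof (rule Y_E_eqI)
  fix w
  show "expands (comp2 a (b + b') w) (\<lambda>p. (Y_E sc a b p + Y_E sc a b' p) w)"
    using expands_add[OF Y_E_expands[OF assms(1,2)] Y_E_expands[OF assms(1,3)], of w w]
    by (simp add: comp2_def[abs_def] plus_fun_def module_hom.add[OF mode_hom[OF assms(1)]])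
qed (simp_all only: assms V_plus)

lemma Y_E_scale_right:
  assumes "a \<in> V" "b \<in> V"
  shows "Y_E sc a (op_scale sc c b) p = op_scale sc c (Y_E sc a b p)"
proof (rule Y_E_eqI)
  fix w
  show "expands (comp2 a (op_scale sc c b) w) (\<lambda>p. op_scale sc c (Y_E sc a b p) w)"
    using expands_scale[OF Y_E_expands[OF assms], of c w]
    by (simp add: comp2_def[abs_def] op_scale_def module_hom.scale[OF mode_hom[OF assms(1)]])
qed (use assms V_scale in auto)

lemma Y_E_zero_right: "a \<in> V \<Longrightarrow> Y_E sc a 0 p = 0"
  using Y_E_scale_right[OF _ V_zero, of a 0 p] by (simp only: ops.scale_zero_left)

text \<open>\<open>ibinom\<close> vanishes at negative lower index, so the bound is
  \<open>- int k\<close>. It is the same for all \<open>w\<close>, hence whole operators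
  vanish.\<close>

lemma Y_E_truncated:
  assumes "a \<in> V" "b \<in> V"
  obtains N where "\<And>p. p < N \<Longrightarrow> Y_E sc a b p = 0"
proof -
  obtain k where k: "\<And>l w p m. k \<le> l \<Longrightarrow>
      Y_E sc a b p w m = kernel_sum ibinom ((mul_diff ^^ l) (comp2 a b w)) (p + int l) m"
    using assms by (rule Y_E_taylor) blast
  have "Y_E sc a b p = 0" if "p < - int k" for p
    using that by (simp add: fun_eq_iff k[of k] kernel_sum_def)
  then show ?thesis by (rule that)
qed

lemma Y_E_id_left:
  assumes "v \<in> V"
  shows "Y_E sc id_op v p = (if p = 0 then v else 0)"
proof -
  have "Y_E sc id_op v p = (\<lambda>w m. if p = 0 then v w m else 0)"
  proof (rule Y_E_eqI[OF id_in_V assms])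
    fix w
    let ?R = "\<lambda>i m. if i = 0 then v w m else 0"
    have "kernel_sum ibinom ?R = (\<lambda>p m. if p = 0 then v w m else 0)"
    proof (intro ext)
      fix p m
      have "kernel_sum ibinom ?R p m = (\<Sum>i\<in>{0}. sc (ibinom i p) (?R i (p + m - i)))"
        by (rule kernel_sum_window) auto
      also have "\<dots> = (if p = 0 then v w m else 0)"
        by (cases "p > 0") (auto simp: ibinom_eq_0)
      finally show "kernel_sum ibinom ?R p m = (if p = 0 then v w m else 0)" .
    qed
    moreover obtain N where "\<And>m. m < N \<Longrightarrow> v w m = 0"
      using mode_laurent1[OF assms, of w] unfolding laurent1_def by blast
    ultimately have "expands ?R (\<lambda>p m. if p = 0 then v w m else 0)"
      using expands_taylor[OF laurent2_single_power(1), of N "v w"] by simp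
    then show "expands (comp2 id_op v w) (\<lambda>p m. if p = 0 then v w m else 0)"
      by (simp add: comp2_def[abs_def] id_op_def)
  qed
  then show ?thesis by (auto simp: fun_eq_iff)
qed

text \<open>The product \<open>v(x)w\<close> has no pole along \<open>x = z\<close>, so the result
  is \<open>v(z+x_0)w\<close>, whose coefficients in \<open>x_0\<close> are the divided derivatives
  of \<open>v\<close>. Both creation properties can be read off.\<close>

lemma Y_E_id_right:
  assumes "v \<in> V"
  shows "Y_E sc v id_op p = (\<lambda>w m. sc (ibinom (m + p) p) (v w (m + p)))"
proof (rule Y_E_eqI[OF assms id_in_V])
  fix w
  let ?R = "\<lambda>i m. if m = 0 then v w i else 0"
  have "kernel_sum ibinom ?R = (\<lambda>p m. sc (ibinom (m + p) p) (v w (m + p)))"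
  proof (intro ext)
    fix p m
    have "kernel_sum ibinom ?R p m = (\<Sum>i\<in>{m + p}. sc (ibinom i p) (?R i (m + p - i)))"
      by (rule kernel_sum_window) auto
    then show "kernel_sum ibinom ?R p m = sc (ibinom (m + p) p) (v w (m + p))" by simp
  qed
  moreover obtain N where "\<And>m. m < N \<Longrightarrow> v w m = 0"
    using mode_laurent1[OF assms, of w] unfolding laurent1_def by blast
  ultimately have "expands ?R (\<lambda>p m. sc (ibinom (m + p) p) (v w (m + p)))"
    using expands_taylor[OF laurent2_single_power(2), of N "v w"] by simp
  moreover have "comp2 v id_op w = ?R"
    by (auto simp: comp2_def id_op_def fun_eq_iff mode_zero[OF assms])
  ultimately show "expands (comp2 v id_op w) (\<lambda>p m. sc (ibinom (m + p) p) (v w (m + p)))"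
    by simp
qed

lemma Y_E_G1_vertex_algebra_base: "G1_vertex_algebra_base (op_scale sc) V (Y_E sc) id_op"
proof
  fix u v :: "'w \<Rightarrow> int \<Rightarrow> 'w"
  assume "u \<in> V" "v \<in> V"
  then obtain N where "\<And>p. p < N \<Longrightarrow> Y_E sc u v p = 0"
    by (rule Y_E_truncated) blast
  then show "laurent1 (Y_E sc u v)"
    unfolding laurent1_def by blast
qed (simp_all add: V_subspace id_in_V Y_in_V Y_E_add_left Y_E_scale_left Y_E_add_right
    Y_E_scale_right Y_E_id_left Y_E_id_right fun_eq_iff)

section \<open>Weak associativity on \<open>W\<close> and on \<open>V\<close>\<close>

lemma module_weak_assoc:
  assumes u: "u \<in> V" and v: "v \<in> V"
  shows "\<exists>l. weak_assoc sc (Y_E sc) (\<lambda>\<alpha>. \<alpha>) l u v w"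
proof -
  obtain k where k: "\<And>l w. k \<le> l \<Longrightarrow> laurent2 ((mul_diff ^^ l) (comp2 u v w))"
    "\<And>l w p m. k \<le> l \<Longrightarrow>
      Y_E sc u v p w m = kernel_sum ibinom ((mul_diff ^^ l) (comp2 u v w)) (p + int l) m"
    using u v by (rule Y_E_taylor) blast
  let ?F = "(mul_diff ^^ k) (comp2 u v w)"
  have F: "laurent2 ?F"
    using k(1)[of k] by simp
  then obtain N where N: "lower2 N ?F"
    by (auto simp: laurent2_def)
  \<comment> \<open>The least power that lifts the lower bound \<open>N\<close> on the exponents of
    \<open>x_1\<close> to 0. It depends on \<open>w\<close>, as the module axiom permits.\<close>
  define l where "l = nat (- N)"
  obtain M where M: "\<And>m. m < M \<Longrightarrow> v w m = 0"
    using mode_laurent1[OF v, of w] by (auto simp: laurent1_def)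
  have "summable_against subst_kernel (comp2 u v w)"
    by (rule summable_against_subst[of M]) (simp add: comp2_def M mode_zero[OF u])
  from kernel_sum_mul_diff_pow[OF Pascal_kernel_subst this, of k]
  have subst: "kernel_sum subst_kernel (comp2 u v w) p m = kernel_sum subst_kernel ?F (p + int k) m" for p m
    by simp
  have eq: "(mul_sum ^^ l) (kernel_sum subst_kernel ?F) p q = (mul_sum ^^ l) (kernel_sum ibinom ?F) p q" for p q
  proof -
    have "(mulx ^^ l) ?F i m = 0" if "i < 0" for i m
      using N that by (simp add: mulx_pow lower2_def l_def)
    then have "sc (subst_kernel i p) ((mulx ^^ l) ?F i m) = sc (ibinom i p) ((mulx ^^ l) ?F i m)" for i m
      by (cases "i < 0") (simp_all add: subst_kernel_def ibinom_symmetric)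
    then have "kernel_sum subst_kernel ((mulx ^^ l) ?F) p q = kernel_sum ibinom ((mulx ^^ l) ?F) p q"
      by (simp only: kernel_sum_def)
    then show ?thesis
      using kernel_sum_mulx_pow[OF Pascal_kernel_subst summable_against_laurent2[OF F], of l p q]
        kernel_sum_mulx_pow[OF Pascal_kernel_ibinom summable_against_laurent2[OF F], of l p q]
      by simp
  qed
  have "weak_assoc sc (Y_E sc) (\<lambda>\<alpha>. \<alpha>) l u v w"
    unfolding weak_assoc_def
  proof (intro allI)
    fix p q
    \<comment> \<open>The arguments are written as differences so that
      \<open>mul_sum_pow_translate\<close> applies with shifts \<open>- int k\<close> and
      \<open>0\<close>.\<close>
    have "binom_mult sc 1 0 1 1 (int l) (subst_sum sc (op_prod [u, v] w)) [p, q]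
        = (mul_sum ^^ l) (\<lambda>p m. kernel_sum subst_kernel ?F (p - (- int k)) (m - 0)) p q"
      unfolding binom_mult_mul_sum subst_sum_conv_kernel_sum op_prod_2 subst by simp
    also have "\<dots> = (mul_sum ^^ l) (\<lambda>p m. kernel_sum ibinom ?F (p - (- int k)) (m - 0)) p q"
      by (simp only: mul_sum_pow_translate eq)
    also have "\<dots> = binom_mult sc 1 0 1 1 (int l) (\<lambda>e. Y_E sc u v (e ! 0) w (e ! 1)) [p, q]"
      unfolding binom_mult_mul_sum by (simp add: k(2)[of k])
    finally show "binom_mult sc 1 0 1 1 (int l) (subst_sum sc (op_prod [u, v] w)) [p, q]
        = binom_mult sc 1 0 1 1 (int l) (\<lambda>e. Y_E sc u v (e ! 0) w (e ! 1)) [p, q]" .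
  qed
  then show ?thesis ..
qed

lemma weak_assoc_iterate_eq:
  assumes \<psi>: "\<psi> \<in> V" and \<phi>: "\<phi> \<in> V" and \<theta>: "\<theta> \<in> V"
    and G: "lower3 N ((mul12 ^^ k') ((mul23 ^^ k') ((mul13 ^^ k) (comp3 \<psi> \<phi> \<theta> w))))"
  shows "(mul_sum ^^ k) (kernel_sum subst_kernel (\<lambda>p q. Y_E sc \<psi> (Y_E sc \<phi> \<theta> q) p w m)) p q
    = (mul_sum ^^ k) (\<lambda>p q. Y_E sc (Y_E sc \<psi> \<phi> p) \<theta> q w m) p q"
proof -
  obtain k1 where k1: "\<And>k w. k1 \<le> k \<Longrightarrow> laurent2 ((mul_diff ^^ k) (comp2 \<psi> \<phi> w))"
    "\<And>k w p m. k1 \<le> k \<Longrightarrow>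
      Y_E sc \<psi> \<phi> p w m = kernel_sum ibinom ((mul_diff ^^ k) (comp2 \<psi> \<phi> w)) (p + int k) m"
    using \<psi> \<phi> by (rule Y_E_taylor) blast
  obtain k2 where k2: "\<And>k w. k2 \<le> k \<Longrightarrow> laurent2 ((mul_diff ^^ k) (comp2 \<phi> \<theta> w))"
    "\<And>k w p m. k2 \<le> k \<Longrightarrow>
      Y_E sc \<phi> \<theta> p w m = kernel_sum ibinom ((mul_diff ^^ k) (comp2 \<phi> \<theta> w)) (p + int k) m"
    using \<phi> \<theta> by (rule Y_E_taylor) blast
  \<comment> \<open>\<open>k'\<close> makes the triple product Laurent but may be too small for the two pairs\<close>
  define K where "K = max k' (max k1 k2)"
  have K: "k' \<le> K" "k1 \<le> K" "k2 \<le> K"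
    by (simp_all add: K_def)
  let ?H = "comp3 \<psi> \<phi> \<theta> w"
  define G where "G = (mul12 ^^ K) ((mul23 ^^ K) ((mul13 ^^ k) ?H))"
  have pow: "(f ^^ K) x = (f ^^ (K - k')) ((f ^^ k') x)" for f :: "'c \<Rightarrow> 'c" and x
    using K(1) by (simp flip: funpow_add o_apply[of "f ^^ _"])
  have "G = (mul12 ^^ (K - k')) ((mul23 ^^ (K - k')) ((mul12 ^^ k') ((mul23 ^^ k') ((mul13 ^^ k) ?H))))"
    unfolding G_def pow by (simp only: funpow_commute[where f = mul12 and g = mul23, OF mul12_mul23])
  then have lowerG: "lower3 N G"
    using G by (simp only: lower3_mul12_pow lower3_mul23_pow)
  define A where "A p q = Y_E sc \<psi> (Y_E sc \<phi> \<theta> q) p w m" for p q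
  define B where "B p q = Y_E sc (Y_E sc \<psi> \<phi> p) \<theta> q w m" for p q
  have right: "(mul_diff ^^ K) (\<lambda>p q. A (p - int k) (q - int K)) p q
    = kernel_sum ibinom (\<lambda>i m. kernel_sum ibinom (G i) q m) p m" for p q
  proof -
    let ?H' = "(mul23 ^^ K) ?H" and ?F = "(mul_diff ^^ K) (comp2 \<phi> \<theta> w)"
    \<comment> \<open>Linearity of the modes of \<open>\<psi>\<close> moves \<open>(y-z)^K\<close>
      inside, where it clears the pole of \<open>\<phi>(y)\<theta>(z)w\<close>.\<close>
    have H': "?H' i = (\<lambda>j m. \<psi> (?F j m) i)" for i
      unfolding mul23_pow module_hom_mul_diff_pow[OF mode_hom[OF \<psi>]] comp3_def comp2_def by simp
    have "expands (\<lambda>i m. kernel_sum ibinom (?H' i) q m) (\<lambda>p m. Y_E sc \<psi> (Y_E sc \<phi> \<theta> (q - int K)) p w m)" for q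
    proof -
      have "comp2 \<psi> (Y_E sc \<phi> \<theta> (q - int K)) w = (\<lambda>i m. kernel_sum ibinom (?H' i) q m)"
        unfolding comp2_def[of \<psi>, abs_def] H'
        using module_hom_kernel_sum[OF mode_hom[OF \<psi>] summable_against_laurent2[OF k2(1)[OF K(3)]]]
        by (simp add: k2(2)[OF K(3)])
      then show ?thesis
        using Y_E_expands[OF \<psi> Y_in_V[OF \<phi> \<theta>, of "q - int K"], of w] by simp
    qed
    then show ?thesis
      unfolding A_def
    proof (rule iterated_expansion_right[rotated 3])
      show "laurent2 (?H' i)" for i
        unfolding H' by (rule laurent2_module_hom[OF mode_hom[OF \<psi>] k2(1)[OF K(3)]])
      show "G = (mul12 ^^ K) ((mul13 ^^ k) ?H')"
        unfolding G_def by (simp only: funpow_commute[where f = mul13 and g = mul23, OF mul13_mul23])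
    qed (fact lowerG)
  qed
  have left: "(mul_sum ^^ k) (\<lambda>p q. B (p - int K) (q - int K)) p q
    = kernel_sum ibinom (\<lambda>j m. kernel_sum ibinom (\<lambda>i j. G i j m) p j) q m" for p q
  proof -
    let ?H' = "(mul12 ^^ K) ?H"
    \<comment> \<open>Now \<open>(x-y)^K\<close> clears the pole of
      \<open>\<psi>(x)\<phi>(y)\<close> on each coefficient of \<open>\<theta>(z)w\<close>
      separately.\<close>
    have H': "(\<lambda>i j. ?H' i j m) = (mul_diff ^^ K) (comp2 \<psi> \<phi> (\<theta> w m))" for m
      unfolding mul12_pow comp3_def comp2_def by simp
    have "expands (\<lambda>j m. kernel_sum ibinom (\<lambda>i j. ?H' i j m) p j) (\<lambda>q m. Y_E sc (Y_E sc \<psi> \<phi> (p - int K)) \<theta> q w m)" for p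
    proof -
      have "comp2 (Y_E sc \<psi> \<phi> (p - int K)) \<theta> w = (\<lambda>j m. kernel_sum ibinom (\<lambda>i j. ?H' i j m) p j)"
        unfolding H' by (simp add: comp2_def[of "Y_E sc \<psi> \<phi> (p - int K)", abs_def] k1(2)[OF K(2)])
      then show ?thesis
        using Y_E_expands[OF Y_in_V[OF \<psi> \<phi>, of "p - int K"] \<theta>, of w] by simp
    qed
    then show ?thesis
      unfolding B_def
    proof (rule iterated_expansion_left[rotated 3])
      show "laurent2 (\<lambda>i j. ?H' i j m)" for m
        unfolding H' by (rule k1(1)[OF K(2)])
      show "G = (mul13 ^^ k) ((mul23 ^^ K) ?H')"
        unfolding G_def
        by (simp only: funpow_commute[where f = mul13 and g = mul23, OF mul13_mul23]
            funpow_commute[where f = mul12 and g = mul23, OF mul12_mul23]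
            funpow_commute[where f = mul12 and g = mul13, OF mul12_mul13])
    qed (fact lowerG)
  qed
  obtain M where M: "\<And>q. q < M \<Longrightarrow> Y_E sc \<phi> \<theta> q = 0"
    using Y_E_truncated[OF \<phi> \<theta>] by blast
  \<comment> \<open>This truncation in \<open>x_2\<close> is what makes the substitution
    \<open>x_1 = x_0+x_2\<close> into \<open>A\<close> well defined.\<close>
  have A_zero: "A p q = 0" if "q < M" for p q
    by (simp add: A_def M that Y_E_zero_right \<psi>)
  let ?A0 = "\<lambda>p q. A p (q - int K)"
  have sA0: "summable_against subst_kernel ?A0"
    by (rule summable_against_subst[of "M + int K"]) (simp add: A_zero)
  have A': "(\<lambda>p q. A (p - int k) (q - int K)) = (mulx ^^ k) ?A0"
    by (simp add: fun_eq_iff mulx_pow)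
  have sA': "summable_against subst_kernel (\<lambda>p q. A (p - int k) (q - int K))"
    unfolding A' using kernel_sum_mulx_pow[OF Pascal_kernel_subst sA0] by blast
  have A0: "kernel_sum subst_kernel ?A0 = (\<lambda>p q. kernel_sum subst_kernel A (p - 0) (q - int K))"
    by (simp add: kernel_sum_def fun_eq_iff algebra_simps)
  have eq: "(mul_sum ^^ k) (kernel_sum subst_kernel A) (p - int K) (q - int K)
      = (mul_sum ^^ k) B (p - int K) (q - int K)" for p q
  proof -
    have "(mul_sum ^^ k) (kernel_sum subst_kernel A) (p - int K) (q - int K)
        = (mul_sum ^^ k) (kernel_sum subst_kernel ?A0) (p - int K) q"
      unfolding A0 mul_sum_pow_translate by simp
    also have "\<dots> = kernel_sum subst_kernel (\<lambda>p q. A (p - int k) (q - int K)) (p - int K) q"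
      unfolding A' using kernel_sum_mulx_pow[OF Pascal_kernel_subst sA0] by simp
    \<comment> \<open>The shift by \<open>x_0^K\<close> is read as \<open>(x_1-x_2)^K\<close> before
      the substitution, the form in which \<open>right\<close> applies.\<close>
    also have "\<dots> = kernel_sum subst_kernel ((mul_diff ^^ K) (\<lambda>p q. A (p - int k) (q - int K))) p q"
      using kernel_sum_mul_diff_pow[OF Pascal_kernel_subst sA'] by simp
    also have "(mul_diff ^^ K) (\<lambda>p q. A (p - int k) (q - int K))
        = (\<lambda>p q. kernel_sum ibinom (\<lambda>i m. kernel_sum ibinom (G i) q m) p m)"
      by (intro ext right)
    also have "kernel_sum subst_kernel \<dots> p q = (mul_sum ^^ k) (\<lambda>p q. B (p - int K) (q - int K)) p q"
      unfolding subst_taylor_taylor[OF lowerG] left ..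
    also have "\<dots> = (mul_sum ^^ k) B (p - int K) (q - int K)"
      by (rule mul_sum_pow_translate)
    finally show ?thesis .
  qed
  \<comment> \<open>Cancelling \<open>x_0^K x_2^K\<close> is only a translation of the two
    exponents.\<close>
  show ?thesis
    using eq[of "p + int K" "q + int K"] unfolding A_def[abs_def] B_def[abs_def] by simp
qed

text \<open>An identity of operators is checked at each \<open>w\<close> and each power of
  \<open>z\<close>. The bound \<open>N\<close> may vary with \<open>w\<close>, but \<open>k\<close>
  may not, because it is the exponent in the conclusion.\<close>

lemma vertex_operators_weak_assoc:
  assumes \<psi>: "\<psi> \<in> V" and \<phi>: "\<phi> \<in> V" and \<theta>: "\<theta> \<in> V"
    and G: "\<And>w. \<exists>N. lower3 N ((mul12 ^^ k') ((mul23 ^^ k') ((mul13 ^^ k) (comp3 \<psi> \<phi> \<theta> w))))"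
  shows "weak_assoc (op_scale sc) (Y_E sc) (Y_E sc) k \<psi> \<phi> \<theta>"
  unfolding weak_assoc_def
proof (intro allI ext)
  fix p q w m
  let ?F = "\<lambda>p q. op_prod [Y_E sc \<psi>, Y_E sc \<phi>] \<theta> [p, q]"
  obtain N where "lower3 N ((mul12 ^^ k') ((mul23 ^^ k') ((mul13 ^^ k) (comp3 \<psi> \<phi> \<theta> w))))"
    using G by blast
  note eq = weak_assoc_iterate_eq[OF \<psi> \<phi> \<theta> this, of m p q]
  obtain M where M: "\<And>q. q < M \<Longrightarrow> Y_E sc \<phi> \<theta> q = 0"
    using Y_E_truncated[OF \<phi> \<theta>] by blast
  have F: "summable_against subst_kernel ?F"
    by (rule summable_against_subst[of M]) (simp add: M Y_E_zero_right \<psi>)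
  have "binom_mult (op_scale sc) 1 0 1 1 (int k)
          (subst_sum (op_scale sc) (op_prod [Y_E sc \<psi>, Y_E sc \<phi>] \<theta>)) [p, q] w m
      = (mul_sum ^^ k) (kernel_sum subst_kernel (\<lambda>p q. Y_E sc \<psi> (Y_E sc \<phi> \<theta> q) p w m)) p q"
    unfolding ops.binom_mult_mul_sum ops.subst_sum_conv_kernel_sum mul_sum_pow_apply[of _ _ _ _ w m]
      op_scale_kernel_sum_apply[OF F] by simp
  also note eq
  also have "(mul_sum ^^ k) (\<lambda>p q. Y_E sc (Y_E sc \<psi> \<phi> p) \<theta> q w m) p q
      = binom_mult (op_scale sc) 1 0 1 1 (int k) (\<lambda>e. Y_E sc (Y_E sc \<psi> \<phi> (e ! 0)) \<theta> (e ! 1)) [p, q] w m"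
    unfolding ops.binom_mult_mul_sum mul_sum_pow_apply[of _ _ _ _ w m] by simp
  finally show "binom_mult (op_scale sc) 1 0 1 1 (int k)
        (subst_sum (op_scale sc) (op_prod [Y_E sc \<psi>, Y_E sc \<phi>] \<theta>)) [p, q] w m
      = binom_mult (op_scale sc) 1 0 1 1 (int k) (\<lambda>e. Y_E sc (Y_E sc \<psi> \<phi> (e ! 0)) \<theta> (e ! 1)) [p, q] w m" .
qed

text \<open>Compatibility supplies one exponent for all three differences, the case
  \<open>k' = k\<close>. It depends on the whole triple, so by itself it yields only the weak form
  of associativity.\<close>

lemma compatible_3_lower3:
  assumes "compatible sc [\<psi>, \<phi>, \<theta>]"
  shows "\<exists>k. \<forall>w. \<exists>N. lower3 N ((mul12 ^^ k) ((mul23 ^^ k) ((mul13 ^^ k) (comp3 \<psi> \<phi> \<theta> w))))"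
proof -
  have length: "length [\<psi>, \<phi>, \<theta>] = 3"
    by simp
  have pairs: "[(i, j). i \<leftarrow> [0..<3], j \<leftarrow> [Suc i..<3]] = [(0, 1), (0, 2), (1, 2)]"
    by (simp add: upt_rec)
  obtain k :: nat where "(\<lambda>w. fold (\<lambda>(i, j). binom_mult sc 1 i (-1) j (int k)) [(0, 1), (0, 2), (1, 2)]
      (op_prod [\<psi>, \<phi>, \<theta>] w)) \<in> Hom_laurent sc 3"
    using assms unfolding compatible_def length pairs by blast
  then have k: "(\<lambda>w. binom_mult sc 1 1 (-1) 2 (int k) (binom_mult sc 1 0 (-1) 2 (int k)
      (binom_mult sc 1 0 (-1) 1 (int k) (op_prod [\<psi>, \<phi>, \<theta>] w)))) \<in> Hom_laurent sc 3"
    by (simp only: fold.simps case_prod_conv o_apply id_apply)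
  have "\<exists>N. lower3 N ((mul12 ^^ k) ((mul23 ^^ k) ((mul13 ^^ k) (comp3 \<psi> \<phi> \<theta> w))))" for w
    using Hom_laurent_3_lower3[OF k, of w]
    unfolding binom_mult_mul12 binom_mult_mul23 binom_mult_mul13 op_prod_3
    by (simp only: funpow_commute[where f = mul12 and g = mul23, OF mul12_mul23]
        funpow_commute[where f = mul12 and g = mul13, OF mul12_mul13])
  then show ?thesis by blast
qed

end

theorem theorem5p22:
  fixes sc :: "complex \<Rightarrow> 'w::ab_group_add \<Rightarrow> 'w"
    and V :: "('w \<Rightarrow> int \<Rightarrow> 'w) set"
  assumes "vector_space sc"
    and "V \<subseteq> E_G1 sc"
    and "module.subspace (op_scale sc) V"
    and "\<And>\<psi>s. \<lbrakk>set \<psi>s \<subseteq> V; length \<psi>s = 2 \<or> length \<psi>s = 3\<rbrakk> \<Longrightarrow> compatible sc \<psi>s"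
    and "id_op \<in> V"
    and "\<And>\<psi> \<phi> n. \<lbrakk>\<psi> \<in> V; \<phi> \<in> V\<rbrakk> \<Longrightarrow> nth_prod sc \<psi> n \<phi> \<in> V"
  shows "weak_axiomatic_G1_vertex_algebra (op_scale sc) V (Y_E sc) id_op
    \<and> faithful_G1_module (op_scale sc) V (Y_E sc) id_op sc (\<lambda>\<alpha>. \<alpha>)
    \<and> ((\<forall>\<psi>\<in>V. \<forall>\<theta>\<in>V. \<exists>k::nat. \<forall>\<phi>\<in>V. \<exists>k'::nat.
          (\<lambda>w. binom_mult sc 1 0 (-1) 1 (int k')
                 (binom_mult sc 1 1 (-1) 2 (int k')
                   (binom_mult sc 1 0 (-1) 2 (int k) (op_prod [\<psi>, \<phi>, \<theta>] w))))
            \<in> Hom_laurent sc 3)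
        \<longrightarrow> axiomatic_G1_vertex_algebra (op_scale sc) V (Y_E sc) id_op)"
proof (intro conjI impI)
  interpret vertex_operator_space sc V
    by (intro vertex_operator_space.intro complex_space.intro vertex_operator_space_axioms.intro) (fact assms)+
  show weak: "weak_axiomatic_G1_vertex_algebra (op_scale sc) V (Y_E sc) id_op"
    using Y_E_G1_vertex_algebra_base
  proof (rule weak_axiomatic_G1_vertex_algebra.intro, unfold_locales)
    fix u v w assume "u \<in> V" "v \<in> V" "w \<in> V"
    moreover from this obtain k
      where "\<forall>x. \<exists>N. lower3 N ((mul12 ^^ k) ((mul23 ^^ k) ((mul13 ^^ k) (comp3 u v w x))))"
      using compatible_3_lower3[OF assms(4)[of "[u, v, w]"]] by auto
    ultimately have "weak_assoc (op_scale sc) (Y_E sc) (Y_E sc) k u v w"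
      by (intro vertex_operators_weak_assoc) blast+
    then show "\<exists>l. weak_assoc (op_scale sc) (Y_E sc) (Y_E sc) l u v w" ..
  qed
  show "faithful_G1_module (op_scale sc) V (Y_E sc) id_op sc (\<lambda>\<alpha>. \<alpha>)"
  proof (intro faithful_G1_module.intro G1_module.intro weak G1_module_axioms.intro
      faithful_G1_module_axioms.intro assms(1))
    show "Vector_Spaces.linear sc sc (\<lambda>w. v w n)" if "v \<in> V" for v n
      using mode_hom[OF that] by (simp add: module_hom_iff_linear)
  qed (simp_all add: mode_laurent1 module_weak_assoc id_op_def op_scale_def)
  assume *: "\<forall>\<psi>\<in>V. \<forall>\<theta>\<in>V. \<exists>k::nat. \<forall>\<phi>\<in>V. \<exists>k'::nat.
          (\<lambda>w. binom_mult sc 1 0 (-1) 1 (int k')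
                 (binom_mult sc 1 1 (-1) 2 (int k')
                   (binom_mult sc 1 0 (-1) 2 (int k) (op_prod [\<psi>, \<phi>, \<theta>] w))))
            \<in> Hom_laurent sc 3"
  show "axiomatic_G1_vertex_algebra (op_scale sc) V (Y_E sc) id_op"
    using Y_E_G1_vertex_algebra_base
  proof (rule axiomatic_G1_vertex_algebra.intro, unfold_locales)
    fix u w assume uw: "u \<in> V" "w \<in> V"
    \<comment> \<open>\<open>k\<close> is fixed before \<open>v\<close> is introduced and only
      \<open>k'\<close> follows it, so \<open>l = k\<close> serves all \<open>v\<close> at
      once.\<close>
    then obtain k where k: "\<forall>v\<in>V. \<exists>k'. (\<lambda>x. binom_mult sc 1 0 (-1) 1 (int k')
        (binom_mult sc 1 1 (-1) 2 (int k') (binom_mult sc 1 0 (-1) 2 (int k) (op_prod [u, v, w] x))))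
        \<in> Hom_laurent sc 3"
      using * by blast
    have "weak_assoc (op_scale sc) (Y_E sc) (Y_E sc) k u v w" if v: "v \<in> V" for v
    proof -
      obtain k' where "(\<lambda>x. binom_mult sc 1 0 (-1) 1 (int k')
        (binom_mult sc 1 1 (-1) 2 (int k') (binom_mult sc 1 0 (-1) 2 (int k) (op_prod [u, v, w] x))))
        \<in> Hom_laurent sc 3"
        using k v by blast
      from Hom_laurent_3_lower3[OF this]
      show ?thesis
        unfolding binom_mult_mul12 binom_mult_mul23 binom_mult_mul13 op_prod_3
        by (rule vertex_operators_weak_assoc[OF uw(1) v uw(2)])
    qed
    then show "\<exists>l. \<forall>v\<in>V. weak_assoc (op_scale sc) (Y_E sc) (Y_E sc) l u v w"
      by blast
  qed
qed

end
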